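(* Let $n \geq 2$ and let $\mathrm{VG}_n$ be the Varchenko--Gel'fand ring of the braid arrangement $\mathcal{A}_n$, as defined in the context. Then the $\mathfrak{S}_n$-invariant subring satisfies \[ \mathrm{VG}_n^{\mathfrak{S}_n} \cong \mathbb{Q}[z]/\langle z^{n+1}\rangle, \] where $\mathbb{Q}[z]$ is the polynomial ring in one indeterminate $z$.
   Context: For $n \geq 1$, $\mathrm{VG}_n$ is the commutative $\mathbb{Q}$-algebra \[\mathrm{VG}_n = \mathbb{Q}[x_{ij} : 1 \leq i \neq j \leq n+1]\big/\langle x_{ij}^2,\; x_{ij}+x_{ji},\; x_{ij}x_{jk}+x_{jk}x_{ki}+x_{ki}x_{ij}\rangle,\] where the relations range over all distinct $i,j,k \in \{1,\dots,n+1\}$. It is graded with each $x_{ij}$ of degree $1$. The symmetric group $\mathfrak{S}_{n+1}$ acts by ring automorphisms via $\sigma \cdot x_{ij} = x_{\sigma(i)\sigma(j)}$. Here $\mathfrak{S}_n \leq \mathfrak{S}_{n+1}$ denotes the subgroup of permutations fixing $n+1$, and $\mathrm{VG}_n^{\mathfrak{S}_n} = \{x \in \mathrm{VG}_n : \sigma\cdot x = x \text{ for all } \sigma \in \mathfrak{S}_n\}$. *)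

theory Defs
  imports
    "HOL-Library.Poly_Mapping"
    "HOL-Combinatorics.Permutations"
    "HOL-Algebra.Algebraic_Closure_Type"
begin

text \<open>
  A monomial in the indeterminates \<open>x\<^bsub>ij\<^esub>\<close> is a finitely supported exponent function on pairs
  \<open>(i, j)\<close>; a polynomial is a finitely supported function from monomials to coefficients.
  The product of the type \<open>mpoly_rat\<close> is convolution, i.e. multiplication of polynomials.
\<close>

type_synonym monom_ix = "(nat \<times> nat) \<Rightarrow>\<^sub>0 nat"
type_synonym mpoly_rat = "monom_ix \<Rightarrow>\<^sub>0 rat"

definition mconst :: "rat \<Rightarrow> mpoly_rat"
  where "mconst c = Poly_Mapping.single 0 c"

definition xvar :: "nat \<Rightarrow> nat \<Rightarrow> mpoly_rat"
  where "xvar i j = Poly_Mapping.single (Poly_Mapping.single (i, j) 1) 1"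

definition var_ix :: "nat \<Rightarrow> (nat \<times> nat) set"
  where "var_ix n = {(i, j). i \<in> {1..n+1} \<and> j \<in> {1..n+1} \<and> i \<noteq> j}"

definition poly_ring :: "nat \<Rightarrow> mpoly_rat ring"
  where "poly_ring n = ring_of_type_algebra
    \<lparr>carrier := {p. \<forall>m \<in> Poly_Mapping.keys p. Poly_Mapping.keys m \<subseteq> var_ix n}\<rparr>"

definition VG_relations :: "nat \<Rightarrow> mpoly_rat set"
  where "VG_relations n =
    {xvar i j ^ 2 | i j. i \<in> {1..n+1} \<and> j \<in> {1..n+1} \<and> i \<noteq> j} \<union>
    {xvar i j + xvar j i | i j. i \<in> {1..n+1} \<and> j \<in> {1..n+1} \<and> i \<noteq> j} \<union>
    {xvar i j * xvar j k + xvar j k * xvar k i + xvar k i * xvar i j | i j k.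
       i \<in> {1..n+1} \<and> j \<in> {1..n+1} \<and> k \<in> {1..n+1} \<and> i \<noteq> j \<and> j \<noteq> k \<and> i \<noteq> k}"

definition VG_ideal :: "nat \<Rightarrow> mpoly_rat set"
  where "VG_ideal n = Idl\<^bsub>poly_ring n\<^esub> (VG_relations n)"

definition VG :: "nat \<Rightarrow> mpoly_rat set ring"
  where "VG n = poly_ring n Quot VG_ideal n"

definition perm_poly :: "(nat \<Rightarrow> nat) \<Rightarrow> mpoly_rat \<Rightarrow> mpoly_rat"
  where "perm_poly \<sigma> p = (\<Sum>m \<in> Poly_Mapping.keys p. mconst (Poly_Mapping.lookup p m) *
    (\<Prod>(i, j) \<in> Poly_Mapping.keys m. xvar (\<sigma> i) (\<sigma> j) ^ Poly_Mapping.lookup m (i, j)))"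

text \<open>
  Elements of \<^term>\<open>VG n\<close> are cosets of \<^term>\<open>VG_ideal n\<close>. Permuting indices is an automorphism of
  the polynomial ring which preserves the ideal, so the induced map on cosets is the direct image:
  see \<open>perm_VG_coset\<close> below.
\<close>

definition perm_VG :: "(nat \<Rightarrow> nat) \<Rightarrow> mpoly_rat set \<Rightarrow> mpoly_rat set"
  where "perm_VG \<sigma> C = perm_poly \<sigma> ` C"

definition VG_invariants :: "nat \<Rightarrow> mpoly_rat set ring"
  where "VG_invariants n = (VG n)
    \<lparr>carrier := {C \<in> carrier (VG n).
       \<forall>\<sigma>. \<sigma> permutes {1..n+1} \<and> \<sigma> (n+1) = n+1 \<longrightarrow> perm_VG \<sigma> C = C}\<rparr>"

definition rat_poly_ring :: "rat poly ring"
  where "rat_poly_ring = ring_of_type_algebra"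


subsection \<open>Well-definedness of the ring and of the action\<close>

lemma carrier_poly_ring:
  "carrier (poly_ring n) = {p. \<forall>m \<in> Poly_Mapping.keys p. Poly_Mapping.keys m \<subseteq> var_ix n}"
  by (simp add: poly_ring_def)

lemma poly_ring_simps [simp]:
  "p \<otimes>\<^bsub>poly_ring n\<^esub> q = p * q" "p \<oplus>\<^bsub>poly_ring n\<^esub> q = p + q"
  "\<one>\<^bsub>poly_ring n\<^esub> = 1" "\<zero>\<^bsub>poly_ring n\<^esub> = 0"
  by (simp_all add: poly_ring_def ring_of_type_algebra_def)

lemma poly_ring_closed:
  assumes "p \<in> carrier (poly_ring n)" "q \<in> carrier (poly_ring n)"
  shows "p + q \<in> carrier (poly_ring n)" "p * q \<in> carrier (poly_ring n)"
    "- p \<in> carrier (poly_ring n)"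
proof -
  show "p + q \<in> carrier (poly_ring n)" "- p \<in> carrier (poly_ring n)"
    using assms Poly_Mapping.keys_add[of p q] by (auto simp: carrier_poly_ring)
  show "p * q \<in> carrier (poly_ring n)"
    unfolding carrier_poly_ring
  proof safe
    fix m i j assume m: "m \<in> Poly_Mapping.keys (p * q)" and e: "(i, j) \<in> Poly_Mapping.keys m"
    obtain a b where "m = a + b" "a \<in> Poly_Mapping.keys p" "b \<in> Poly_Mapping.keys q"
      using m keys_mult[of p q] by auto
    then show "(i, j) \<in> var_ix n"
      using assms e Poly_Mapping.keys_add[of a b] unfolding carrier_poly_ring by blast
  qed
qed

lemma poly_ring_0_1: "0 \<in> carrier (poly_ring n)" "1 \<in> carrier (poly_ring n)"
  by (simp_all add: carrier_poly_ring)

lemma cring_poly_ring: "cring (poly_ring n)"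
proof (intro cringI abelian_groupI comm_monoidI)
  fix p assume "p \<in> carrier (poly_ring n)"
  then show "\<exists>q \<in> carrier (poly_ring n). q \<oplus>\<^bsub>poly_ring n\<^esub> p = \<zero>\<^bsub>poly_ring n\<^esub>"
    by (intro bexI[of _ "- p"]) (auto intro: poly_ring_closed)
qed (auto simp: algebra_simps intro: poly_ring_closed poly_ring_0_1)

lemma xvar_closed: "(i, j) \<in> var_ix n \<Longrightarrow> xvar i j \<in> carrier (poly_ring n)"
  by (simp add: xvar_def carrier_poly_ring)

lemma VG_relations_closed: "VG_relations n \<subseteq> carrier (poly_ring n)"
proof -
  have "xvar i j \<in> carrier (poly_ring n)" if "i \<in> {1..n+1}" "j \<in> {1..n+1}" "i \<noteq> j" for i j
    using that by (intro xvar_closed) (auto simp: var_ix_def)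
  then show ?thesis
    unfolding VG_relations_def
    by (auto simp: power2_eq_square simp del: atLeastAtMost_iff intro!: poly_ring_closed)
qed

lemma ideal_VG_ideal: "ideal (VG_ideal n) (poly_ring n)"
  unfolding VG_ideal_def
  by (intro ring.genideal_ideal cring.axioms(1) cring_poly_ring VG_relations_closed)

lemma cring_VG: "cring (VG n)"
  unfolding VG_def by (intro ideal.quotient_is_cring ideal_VG_ideal cring_poly_ring)


definition perm_monom :: "(nat \<Rightarrow> nat) \<Rightarrow> monom_ix \<Rightarrow> mpoly_rat"
  where "perm_monom \<sigma> m =
    (\<Prod>(i, j) \<in> Poly_Mapping.keys m. xvar (\<sigma> i) (\<sigma> j) ^ Poly_Mapping.lookup m (i, j))"

lemma perm_monom_add: "perm_monom \<sigma> (a + b) = perm_monom \<sigma> a * perm_monom \<sigma> b"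
proof -
  let ?K = "Poly_Mapping.keys a \<union> Poly_Mapping.keys b"
  have *: "perm_monom \<sigma> m =
      (\<Prod>e \<in> ?K. xvar (\<sigma> (fst e)) (\<sigma> (snd e)) ^ Poly_Mapping.lookup m e)"
    if "Poly_Mapping.keys m \<subseteq> ?K" for m
    unfolding perm_monom_def case_prod_unfold prod.collapse using that
    by (intro prod.mono_neutral_left) (auto simp: in_keys_iff)
  show ?thesis
    using Poly_Mapping.keys_add[of a b]
    by (simp add: * lookup_add power_add prod.distrib)
qed

lemma perm_monom_0: "perm_monom \<sigma> 0 = 1"
  by (simp add: perm_monom_def)

lemma mconst_simps: "mconst 0 = 0" "mconst 1 = 1" "mconst (c + d) = mconst c + mconst d"
    "mconst (c * d) = mconst c * mconst d"
  by (simp_all add: mconst_def single_add mult_single)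

lemma perm_poly_add: "perm_poly \<sigma> (p + q) = perm_poly \<sigma> p + perm_poly \<sigma> q"
  unfolding perm_poly_def perm_monom_def[symmetric]
  by (rule setsum_keys_plus_distrib) (simp_all add: mconst_simps algebra_simps)

lemma perm_poly_single: "perm_poly \<sigma> (Poly_Mapping.single m c) = mconst c * perm_monom \<sigma> m"
  by (simp add: perm_poly_def perm_monom_def mconst_simps)

lemma perm_poly_0 [simp]: "perm_poly \<sigma> 0 = 0"
  by (simp add: perm_poly_def)

lemma perm_poly_1 [simp]: "perm_poly \<sigma> 1 = 1"
  using perm_poly_single[of \<sigma> 0 1] by (simp add: perm_monom_0 mconst_simps)

lemma perm_poly_xvar [simp]: "perm_poly \<sigma> (xvar i j) = xvar (\<sigma> i) (\<sigma> j)"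
  unfolding xvar_def[of i j] perm_poly_single by (simp add: perm_monom_def mconst_simps)

lemma perm_poly_Const [simp]: "perm_poly \<sigma> (mconst c) = mconst c"
  unfolding mconst_def[of c] perm_poly_single by (simp add: perm_monom_0 mconst_def)

lemma mpoly_induct [case_names single add]:
  fixes p :: mpoly_rat
  assumes single: "\<And>m c. P (Poly_Mapping.single m c)"
    and add: "\<And>p q. P p \<Longrightarrow> P q \<Longrightarrow> P (p + q)"
  shows "P p"
proof -
  have "P (\<Sum>m\<in>A. Poly_Mapping.single m (Poly_Mapping.lookup p m))" if "finite A" for A
    using that
  proof (induction A rule: finite_induct)
    case empty
    show ?case using single[of 0 0] by simp
  qed (simp add: assms)
  moreover have "(\<Sum>m\<in>Poly_Mapping.keys p. Poly_Mapping.single m (Poly_Mapping.lookup p m)) = p"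
    by (rule poly_mapping_eqI) (auto simp: lookup_sum lookup_single when_def in_keys_iff)
  ultimately show ?thesis
    by (metis finite_keys)
qed

lemma perm_poly_mult: "perm_poly \<sigma> (p * q) = perm_poly \<sigma> p * perm_poly \<sigma> q"
proof (induction p rule: mpoly_induct)
  case (single m c)
  show ?case
  proof (induction q rule: mpoly_induct)
    case (single m' c')
    show ?case
      by (simp add: mult_single perm_poly_single perm_monom_add mconst_simps)
  qed (simp add: perm_poly_add algebra_simps)
qed (simp add: perm_poly_add algebra_simps)

lemma perm_poly_power: "perm_poly \<sigma> (p ^ k) = perm_poly \<sigma> p ^ k"
  by (induction k) (simp_all add: perm_poly_mult)

lemma perm_poly_prod: "perm_poly \<sigma> (\<Prod>i\<in>A. f i) = (\<Prod>i\<in>A. perm_poly \<sigma> (f i))"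
  by (induction A rule: infinite_finite_induct) (simp_all add: perm_poly_mult)

lemma perm_poly_comp: "perm_poly \<sigma> (perm_poly \<tau> p) = perm_poly (\<sigma> \<circ> \<tau>) p"
proof (induction p rule: mpoly_induct)
  case (single m c)
  show ?case
    by (simp add: perm_poly_single perm_poly_mult perm_monom_def perm_poly_prod
        perm_poly_power case_prod_unfold)
qed (simp add: perm_poly_add)

lemma perm_poly_id: "perm_poly id p = p"
proof (induction p rule: mpoly_induct)
  case (single m c)
  have xvar_pow: "xvar i j ^ k = Poly_Mapping.single (Poly_Mapping.single (i, j) k) 1" for i j k
    by (induction k) (simp_all add: xvar_def mult_single single_add[symmetric])
  have prod_single: "(\<Prod>e\<in>A. Poly_Mapping.single (f e) 1) =
      (Poly_Mapping.single (\<Sum>e\<in>A. f e) 1 :: mpoly_rat)"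
    if "finite A" for A :: "(nat \<times> nat) set" and f
    using that by (induction A rule: finite_induct) (simp_all add: mult_single)
  have "m = (\<Sum>e\<in>Poly_Mapping.keys m. Poly_Mapping.single e (Poly_Mapping.lookup m e))"
    by (rule poly_mapping_eqI) (auto simp: lookup_sum lookup_single when_def in_keys_iff)
  then have "perm_monom id m = Poly_Mapping.single m 1"
    by (simp add: perm_monom_def xvar_pow case_prod_unfold prod_single)
  then show ?case
    by (simp only: perm_poly_single mconst_def mult_single) simp
qed (simp add: perm_poly_add)

lemma perm_poly_closed:
  assumes "\<sigma> permutes {1..n+1}" "p \<in> carrier (poly_ring n)"
  shows "perm_poly \<sigma> p \<in> carrier (poly_ring n)"
proof -
  have sum_closed: "(\<Sum>i\<in>A. f i) \<in> carrier (poly_ring n)"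
    if "\<And>i. i \<in> A \<Longrightarrow> f i \<in> carrier (poly_ring n)" for A and f :: "monom_ix \<Rightarrow> mpoly_rat"
    using that
    by (induction A rule: infinite_finite_induct) (auto intro: poly_ring_closed poly_ring_0_1)
  have prod_closed: "(\<Prod>i\<in>A. f i) \<in> carrier (poly_ring n)"
    if "\<And>i. i \<in> A \<Longrightarrow> f i \<in> carrier (poly_ring n)" for A and f :: "nat \<times> nat \<Rightarrow> mpoly_rat"
    using that
    by (induction A rule: infinite_finite_induct) (auto intro: poly_ring_closed poly_ring_0_1)
  have pow_closed: "q ^ k \<in> carrier (poly_ring n)" if "q \<in> carrier (poly_ring n)" for q k
    using that by (induction k) (auto intro: poly_ring_closed poly_ring_0_1)
  have mconst_closed: "mconst c \<in> carrier (poly_ring n)" for c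
    by (simp add: mconst_def carrier_poly_ring)
  have X: "xvar (\<sigma> i) (\<sigma> j) \<in> carrier (poly_ring n)" if "(i, j) \<in> var_ix n" for i j
  proof (rule xvar_closed)
    show "(\<sigma> i, \<sigma> j) \<in> var_ix n"
      using that permutes_in_image[OF assms(1)] inj_eq[OF permutes_inj[OF assms(1)]]
      unfolding var_ix_def by blast
  qed
  show ?thesis
    unfolding perm_poly_def
    using assms(2)[unfolded carrier_poly_ring]
    by (intro sum_closed poly_ring_closed(2) mconst_closed prod_closed)
      (auto intro!: pow_closed X)
qed

lemma perm_poly_hom:
  assumes "\<sigma> permutes {1..n+1}"
  shows "perm_poly \<sigma> \<in> ring_hom (poly_ring n) (poly_ring n)"
  using assms by (intro ring_hom_memI) (auto simp: perm_poly_closed perm_poly_add perm_poly_mult)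

lemma perm_poly_relations:
  assumes "\<sigma> permutes {1..n+1}" "r \<in> VG_relations n"
  shows "perm_poly \<sigma> r \<in> VG_relations n"
proof -
  have *: "\<sigma> i \<in> {1..n+1} \<longleftrightarrow> i \<in> {1..n+1}" "\<sigma> i = \<sigma> j \<longleftrightarrow> i = j" for i j
    using permutes_in_image[OF assms(1)] inj_eq[OF permutes_inj[OF assms(1)]] by blast+
  from assms(2) consider
      i j where "r = xvar i j ^ 2" "i \<in> {1..n+1}" "j \<in> {1..n+1}" "i \<noteq> j"
    | i j where "r = xvar i j + xvar j i" "i \<in> {1..n+1}" "j \<in> {1..n+1}" "i \<noteq> j"
    | i j k where "r = xvar i j * xvar j k + xvar j k * xvar k i + xvar k i * xvar i j"
        "i \<in> {1..n+1}" "j \<in> {1..n+1}" "k \<in> {1..n+1}" "i \<noteq> j" "j \<noteq> k" "i \<noteq> k"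
    unfolding VG_relations_def by blast
  then show ?thesis
  proof cases
    case 1
    then have "perm_poly \<sigma> r = xvar (\<sigma> i) (\<sigma> j) ^ 2" by (simp add: perm_poly_power)
    moreover have "\<sigma> i \<in> {1..n+1}" "\<sigma> j \<in> {1..n+1}" "\<sigma> i \<noteq> \<sigma> j" using 1 * by blast+
    ultimately show ?thesis unfolding VG_relations_def by blast
  next
    case 2
    then have "perm_poly \<sigma> r = xvar (\<sigma> i) (\<sigma> j) + xvar (\<sigma> j) (\<sigma> i)" by (simp add: perm_poly_add)
    moreover have "\<sigma> i \<in> {1..n+1}" "\<sigma> j \<in> {1..n+1}" "\<sigma> i \<noteq> \<sigma> j" using 2 * by blast+
    ultimately show ?thesis unfolding VG_relations_def by blast
  next
    case 3
    then have "perm_poly \<sigma> r = xvar (\<sigma> i) (\<sigma> j) * xvar (\<sigma> j) (\<sigma> k) +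
        xvar (\<sigma> j) (\<sigma> k) * xvar (\<sigma> k) (\<sigma> i) + xvar (\<sigma> k) (\<sigma> i) * xvar (\<sigma> i) (\<sigma> j)"
      by (simp add: perm_poly_add perm_poly_mult)
    moreover have "\<sigma> i \<in> {1..n+1}" "\<sigma> j \<in> {1..n+1}" "\<sigma> k \<in> {1..n+1}"
        "\<sigma> i \<noteq> \<sigma> j" "\<sigma> j \<noteq> \<sigma> k" "\<sigma> i \<noteq> \<sigma> k" using 3 * by blast+
    ultimately show ?thesis unfolding VG_relations_def by blast
  qed
qed

lemma perm_poly_ideal_subset:
  assumes "\<sigma> permutes {1..n+1}"
  shows "perm_poly \<sigma> ` VG_ideal n \<subseteq> VG_ideal n"
proof -
  interpret R: cring "poly_ring n" by (rule cring_poly_ring)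
  interpret h: ring_hom_ring "poly_ring n" "poly_ring n" "perm_poly \<sigma>"
    by (intro ring_hom_ringI2 R.ring_axioms perm_poly_hom assms)
  let ?J = "{r \<in> carrier (poly_ring n). perm_poly \<sigma> r \<in> VG_ideal n}"
  have "ideal ?J (poly_ring n)"
    using ideal_VG_ideal by (rule h.ideal_vimage)
  moreover have "VG_relations n \<subseteq> ?J"
    using VG_relations_closed perm_poly_relations[OF assms]
      R.genideal_self[OF VG_relations_closed] unfolding VG_ideal_def by blast
  ultimately have "VG_ideal n \<subseteq> ?J"
    unfolding VG_ideal_def[of n] using R.genideal_minimal by (simp add: VG_ideal_def)
  then show ?thesis by blast
qed

lemma perm_poly_ideal:
  assumes "\<sigma> permutes {1..n+1}"
  shows "perm_poly \<sigma> ` VG_ideal n = VG_ideal n"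
proof
  show "VG_ideal n \<subseteq> perm_poly \<sigma> ` VG_ideal n"
  proof
    fix p assume "p \<in> VG_ideal n"
    then have "perm_poly (inv_into UNIV \<sigma>) p \<in> VG_ideal n"
      using perm_poly_ideal_subset[OF permutes_inv[OF assms]] by blast
    moreover have "perm_poly \<sigma> (perm_poly (inv_into UNIV \<sigma>) p) = p"
      by (simp add: perm_poly_comp permutes_inv_o[OF assms] perm_poly_id)
    ultimately show "p \<in> perm_poly \<sigma> ` VG_ideal n" by force
  qed
qed (rule perm_poly_ideal_subset[OF assms])

lemma perm_VG_coset:
  assumes "\<sigma> permutes {1..n+1}"
  shows "perm_VG \<sigma> (VG_ideal n +>\<^bsub>poly_ring n\<^esub> p) = VG_ideal n +>\<^bsub>poly_ring n\<^esub> perm_poly \<sigma> p"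
proof -
  have "VG_ideal n +>\<^bsub>poly_ring n\<^esub> q = (\<lambda>h. h + q) ` VG_ideal n" for q
    by (auto simp: a_r_coset_def r_coset_def)
  then have "perm_VG \<sigma> (VG_ideal n +>\<^bsub>poly_ring n\<^esub> p) =
      (\<lambda>h. h + perm_poly \<sigma> p) ` (perm_poly \<sigma> ` VG_ideal n)"
    by (simp add: perm_VG_def image_image perm_poly_add)
  then show ?thesis
    by (auto simp: perm_poly_ideal[OF assms] a_r_coset_def r_coset_def)
qed

end

theory Submission
  imports Defs
begin

text \<open>
  Write \<open>y\<^sub>i = x\<^bsub>i,n+1\<^esub>\<close> and \<open>z = y\<^sub>1 + \<dots> + y\<^sub>n\<close>. Since \<open>y\<^sub>i\<^sup>2 = 0\<close>, the power \<open>z\<^sup>k\<close> is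
  \<open>k! e\<^sub>k(y)\<close>, so \<open>z\<^bsup>n+1\<^esup> = 0\<close>. The substitution \<open>x\<^bsub>ij\<^esub> \<mapsto> a\<^sub>i\<close> for \<open>i < j\<close>, with
  \<open>a\<^sub>i\<^sup>2 = 0\<close>, respects the relations and sends \<open>z\<^sup>n\<close> to \<open>n! a\<^sub>1 \<dots> a\<^sub>n \<noteq> 0\<close>.

  Every invariant is a polynomial in \<open>z\<close>, by induction on \<open>n\<close>: as a module over \<open>VG\<^bsub>n-1\<^esub>\<close>, the
  ring \<open>VG\<^sub>n\<close> is generated by \<open>1, y\<^sub>1, \<dots>, y\<^sub>n\<close>, so up to permutation one has to symmetrize \<open>w\<close>
  and \<open>y\<^sub>n w\<close> with \<open>w \<in> VG\<^bsub>n-1\<^esub>\<close>. Symmetrizing over the permutations of \<open>1, \<dots>, n-1\<close> first, the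
  induction hypothesis turns \<open>w\<close> into a polynomial in \<open>z\<^sub>n = \<Sum>\<^bsub>j<n\<^esub> x\<^bsub>jn\<^esub>\<close>. It remains to
  evaluate \<open>\<Sum>\<^sub>r z\<^sub>r\<^sup>k\<close> and \<open>\<Sum>\<^sub>r y\<^sub>r z\<^sub>r\<^sup>k\<close> for \<open>z\<^sub>r = \<Sum>\<^bsub>j\<noteq>r\<^esub> x\<^bsub>jr\<^esub>\<close>. By the identity
  \<open>\<Sum>\<^bsub>r\<in>S\<^esub> \<Prod>\<^bsub>j\<in>S-{r}\<^esub> x\<^bsub>jr\<^esub> = 0\<close> for \<open>card S \<ge> 2\<close>, the former vanishes for \<open>k > 0\<close> and the latter is
  \<open>k! e\<^bsub>k+1\<^esub>(y) = z\<^bsup>k+1\<^esup> / (k+1)\<close>.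
\<close>

subsection \<open>Congruence modulo the relations\<close>

lemma of_nat_eq_mconst: "of_nat m = mconst (of_nat m)"
  by (induction m) (simp_all add: mconst_simps)

text \<open>Evaluation homomorphism for arbitrary images of the variables. It serves twice: to kill
  the variables outside \<open>var_ix n\<close>, and, with \<open>min_subst\<close>, to detect that
  a power of the star sum is nonzero.\<close>

definition mpoly_subst :: "(nat \<times> nat \<Rightarrow> mpoly_rat) \<Rightarrow> mpoly_rat \<Rightarrow> mpoly_rat"
  where "mpoly_subst f p = (\<Sum>m \<in> Poly_Mapping.keys p. mconst (Poly_Mapping.lookup p m) *
    (\<Prod>e \<in> Poly_Mapping.keys m. f e ^ Poly_Mapping.lookup m e))"

lemma mpoly_subst_add: "mpoly_subst f (p + q) = mpoly_subst f p + mpoly_subst f q"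
  unfolding mpoly_subst_def
  by (rule setsum_keys_plus_distrib) (simp_all add: mconst_simps algebra_simps)

lemma mpoly_subst_single:
  "mpoly_subst f (Poly_Mapping.single m c) =
    mconst c * (\<Prod>e \<in> Poly_Mapping.keys m. f e ^ Poly_Mapping.lookup m e)"
  by (simp add: mpoly_subst_def mconst_simps)

lemma mpoly_subst_mult: "mpoly_subst f (p * q) = mpoly_subst f p * mpoly_subst f q"
proof (induction p rule: mpoly_induct)
  case (single a c)
  show ?case
  proof (induction q rule: mpoly_induct)
    case (single b d)
    let ?K = "Poly_Mapping.keys a \<union> Poly_Mapping.keys b"
    have *: "(\<Prod>e \<in> Poly_Mapping.keys m. f e ^ Poly_Mapping.lookup m e) =
        (\<Prod>e \<in> ?K. f e ^ Poly_Mapping.lookup m e)"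
      if "Poly_Mapping.keys m \<subseteq> ?K" for m
      using that by (intro prod.mono_neutral_left) (auto simp: in_keys_iff)
    have "(\<Prod>e \<in> Poly_Mapping.keys (a + b). f e ^ Poly_Mapping.lookup (a + b) e) =
        (\<Prod>e \<in> Poly_Mapping.keys a. f e ^ Poly_Mapping.lookup a e) *
        (\<Prod>e \<in> Poly_Mapping.keys b. f e ^ Poly_Mapping.lookup b e)"
      unfolding *[OF Poly_Mapping.keys_add] *[OF Un_upper1] *[OF Un_upper2]
      by (simp add: lookup_add power_add prod.distrib)
    then show ?case
      by (simp add: mult_single mpoly_subst_single mconst_simps)
  qed (simp add: mpoly_subst_add algebra_simps)
qed (simp add: mpoly_subst_add algebra_simps)

lemma mpoly_subst_mconst: "mpoly_subst f (mconst c) = mconst c"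
  unfolding mconst_def[of c] mpoly_subst_single by (simp add: mconst_def)

lemma mpoly_subst_0: "mpoly_subst f 0 = 0"
  by (simp add: mpoly_subst_def)

lemma mpoly_subst_1: "mpoly_subst f 1 = 1"
  using mpoly_subst_mconst[of f 1] by (simp add: mconst_simps)

lemma mpoly_subst_xvar: "mpoly_subst f (xvar i j) = f (i, j)"
  unfolding xvar_def mpoly_subst_single by (simp add: mconst_simps)

lemma mpoly_subst_prod: "mpoly_subst f (\<Prod>i\<in>A. g i) = (\<Prod>i\<in>A. mpoly_subst f (g i))"
  by (induction A rule: infinite_finite_induct) (simp_all add: mpoly_subst_mult mpoly_subst_1)

lemma mpoly_subst_id_on:
  assumes "p \<in> carrier (poly_ring n)" "\<And>i j. (i, j) \<in> var_ix n \<Longrightarrow> f (i, j) = xvar i j"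
  shows "mpoly_subst f p = p"
proof -
  have "mpoly_subst f p = perm_poly id p"
    unfolding mpoly_subst_def perm_poly_def using assms
    by (intro sum.cong refl arg_cong2[where f = "(*)"] prod.cong)
      (auto simp: carrier_poly_ring subset_iff)
  then show ?thesis by (simp add: perm_poly_id)
qed

lemma poly_ring_sum_closed:
  "(\<And>i. i \<in> A \<Longrightarrow> f i \<in> carrier (poly_ring n)) \<Longrightarrow> (\<Sum>i\<in>A. f i) \<in> carrier (poly_ring n)"
  by (induction A rule: infinite_finite_induct) (auto intro: poly_ring_closed poly_ring_0_1)

lemma poly_ring_prod_closed:
  "(\<And>i. i \<in> A \<Longrightarrow> f i \<in> carrier (poly_ring n)) \<Longrightarrow> (\<Prod>i\<in>A. f i) \<in> carrier (poly_ring n)"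
  by (induction A rule: infinite_finite_induct) (auto intro: poly_ring_closed poly_ring_0_1)

lemma poly_ring_power_closed:
  "p \<in> carrier (poly_ring n) \<Longrightarrow> p ^ k \<in> carrier (poly_ring n)"
  by (induction k) (auto intro: poly_ring_closed poly_ring_0_1)

lemma mconst_closed: "mconst c \<in> carrier (poly_ring n)"
  by (simp add: mconst_def carrier_poly_ring)

text \<open>Taken in the polynomial ring in all variables \<open>x\<^bsub>ij\<^esub>\<close>, so that no side conditions about
  carriers arise.\<close>

inductive_set VG_full_ideal :: "nat \<Rightarrow> mpoly_rat set" for n where
  gen: "r \<in> VG_relations n \<Longrightarrow> p * r \<in> VG_full_ideal n"
| zero: "0 \<in> VG_full_ideal n"
| add: "p \<in> VG_full_ideal n \<Longrightarrow> q \<in> VG_full_ideal n \<Longrightarrow> p + q \<in> VG_full_ideal n"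

lemma VG_full_ideal_mult: "p \<in> VG_full_ideal n \<Longrightarrow> q * p \<in> VG_full_ideal n"
proof (induction rule: VG_full_ideal.induct)
  case (gen r p)
  then have "(q * p) * r \<in> VG_full_ideal n" by (rule VG_full_ideal.gen)
  then show ?case by (simp add: mult.assoc)
qed (auto simp: distrib_left intro: VG_full_ideal.intros)

lemma VG_full_ideal_mult_right: "p \<in> VG_full_ideal n \<Longrightarrow> p * q \<in> VG_full_ideal n"
  using VG_full_ideal_mult[of p n q] by (simp add: mult.commute)

lemma VG_full_ideal_uminus: "p \<in> VG_full_ideal n \<Longrightarrow> - p \<in> VG_full_ideal n"
  using VG_full_ideal_mult[of p n "- 1"] by simp

lemma VG_full_ideal_relation: "r \<in> VG_relations n \<Longrightarrow> r \<in> VG_full_ideal n"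
  using VG_full_ideal.gen[of r n 1] by simp

lemma VG_full_ideal_mono: "m \<le> n \<Longrightarrow> VG_full_ideal m \<subseteq> VG_full_ideal n"
proof
  fix p assume mn: "m \<le> n" and "p \<in> VG_full_ideal m"
  from this(2) show "p \<in> VG_full_ideal n"
  proof (induction rule: VG_full_ideal.induct)
    case (gen r p)
    have "i \<in> {1..m+1} \<Longrightarrow> i \<in> {1..n+1}" for i using mn by simp
    then have "VG_relations m \<subseteq> VG_relations n"
      unfolding VG_relations_def by blast
    with gen show ?case by (blast intro: VG_full_ideal.gen)
  qed (auto intro: VG_full_ideal.intros)
qed

lemma VG_full_ideal_perm:
  assumes "\<sigma> permutes {1..n+1}" "p \<in> VG_full_ideal n"
  shows "perm_poly \<sigma> p \<in> VG_full_ideal n"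
  using assms(2)
  by induction (auto simp: perm_poly_mult perm_poly_add
      intro: VG_full_ideal.intros perm_poly_relations[OF assms(1)])

text \<open>Sending every variable outside \<open>var_ix n\<close> to 0 is a retraction of the full
  polynomial ring onto \<open>poly_ring n\<close>. It fixes the relations, so it carries each
  \<open>p * r\<close> into \<open>VG_ideal n\<close>, while elements of the carrier stay where they
  are.\<close>

lemma VG_ideal_eq: "VG_ideal n = VG_full_ideal n \<inter> carrier (poly_ring n)"
proof
  interpret R: cring "poly_ring n" by (rule cring_poly_ring)
  interpret I: ideal "VG_ideal n" "poly_ring n" by (rule ideal_VG_ideal)
  have uminus: "\<ominus>\<^bsub>poly_ring n\<^esub> p = - p" if "p \<in> carrier (poly_ring n)" for p
    using that by (intro R.minus_equality) (auto intro: poly_ring_closed)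
  have "ideal (VG_full_ideal n \<inter> carrier (poly_ring n)) (poly_ring n)"
  proof (rule idealI[OF R.ring_axioms])
    show "subgroup (VG_full_ideal n \<inter> carrier (poly_ring n)) (add_monoid (poly_ring n))"
    proof (rule R.add.subgroupI)
      show "VG_full_ideal n \<inter> carrier (poly_ring n) \<noteq> {}"
        using VG_full_ideal.zero poly_ring_0_1(1) by blast
    qed (auto simp: uminus a_inv_def[symmetric]
        intro: poly_ring_closed VG_full_ideal_uminus VG_full_ideal.add)
  qed (auto intro: poly_ring_closed VG_full_ideal_mult VG_full_ideal_mult_right)
  then show "VG_ideal n \<subseteq> VG_full_ideal n \<inter> carrier (poly_ring n)"
    unfolding VG_ideal_def using VG_relations_closed VG_full_ideal_relation
    by (intro R.genideal_minimal) auto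
  let ?f = "\<lambda>(i, j). if (i, j) \<in> var_ix n then xvar i j else 0"
  have fixed: "mpoly_subst ?f p = p" if "p \<in> carrier (poly_ring n)" for p
    using that by (rule mpoly_subst_id_on) simp
  have closed: "mpoly_subst ?f p \<in> carrier (poly_ring n)" for p
  proof (induction p rule: mpoly_induct)
    case (single m c)
    show ?case
      unfolding mpoly_subst_single
      by (intro poly_ring_closed(2) poly_ring_prod_closed poly_ring_power_closed mconst_closed)
        (auto intro: xvar_closed poly_ring_0_1)
  qed (auto simp: mpoly_subst_add intro: poly_ring_closed)
  have "mpoly_subst ?f p \<in> VG_ideal n" if "p \<in> VG_full_ideal n" for p
    using that
  proof induction
    case (gen r p)
    then have "r \<in> VG_ideal n" "r \<in> carrier (poly_ring n)"
      using R.genideal_self[OF VG_relations_closed] VG_relations_closed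
      unfolding VG_ideal_def by blast+
    then show ?case
      using I.I_l_closed[of r "mpoly_subst ?f p"] closed by (simp add: mpoly_subst_mult fixed)
  next
    case zero
    then show ?case using I.zero_closed by (simp add: mpoly_subst_0)
  next
    case (add p q)
    then show ?case using I.a_closed[of "mpoly_subst ?f p"] by (simp add: mpoly_subst_add)
  qed
  then show "VG_full_ideal n \<inter> carrier (poly_ring n) \<subseteq> VG_ideal n"
    using fixed by force
qed

section \<open>Congruence calculus and the defining relations as congruences\<close>

definition VG_cong :: "nat \<Rightarrow> mpoly_rat \<Rightarrow> mpoly_rat \<Rightarrow> bool"
  where "VG_cong n p q \<longleftrightarrow> p - q \<in> VG_full_ideal n"

lemma VG_cong_refl [simp, intro]: "VG_cong n p p"
  by (simp add: VG_cong_def VG_full_ideal.zero)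

lemma VG_cong_sym: "VG_cong n p q \<Longrightarrow> VG_cong n q p"
  using VG_full_ideal_uminus[of "p - q" n] by (simp add: VG_cong_def)

lemma VG_cong_trans [trans]: "VG_cong n p q \<Longrightarrow> VG_cong n q r \<Longrightarrow> VG_cong n p r"
  using VG_full_ideal.add[of "p - q" n "q - r"] by (simp add: VG_cong_def)

lemma VG_cong_add: "VG_cong n p q \<Longrightarrow> VG_cong n p' q' \<Longrightarrow> VG_cong n (p + p') (q + q')"
  using VG_full_ideal.add[of "p - q" n "p' - q'"] by (simp add: VG_cong_def algebra_simps)

lemma VG_cong_uminus: "VG_cong n p q \<Longrightarrow> VG_cong n (- p) (- q)"
  using VG_full_ideal_uminus[of "p - q" n] by (simp add: VG_cong_def algebra_simps)

lemma VG_cong_diff: "VG_cong n p q \<Longrightarrow> VG_cong n p' q' \<Longrightarrow> VG_cong n (p - p') (q - q')"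
  using VG_cong_add[of n p q "- p'" "- q'"] VG_cong_uminus by simp

lemma VG_cong_mult_left: "VG_cong n p q \<Longrightarrow> VG_cong n (r * p) (r * q)"
  using VG_full_ideal_mult[of "p - q" n r] by (simp add: VG_cong_def algebra_simps)

lemma VG_cong_sum:
  "(\<And>i. i \<in> A \<Longrightarrow> VG_cong n (f i) (g i)) \<Longrightarrow> VG_cong n (\<Sum>i\<in>A. f i) (\<Sum>i\<in>A. g i)"
  by (induction A rule: infinite_finite_induct) (auto intro: VG_cong_add)

lemma VG_cong_mono: "VG_cong m p q \<Longrightarrow> m \<le> n \<Longrightarrow> VG_cong n p q"
  using VG_full_ideal_mono by (auto simp: VG_cong_def)

lemma perm_poly_uminus: "perm_poly \<sigma> (- p) = - perm_poly \<sigma> p"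
  using perm_poly_add[of \<sigma> p "- p"] by (simp add: eq_neg_iff_add_eq_0 add.commute)

lemma perm_poly_diff: "perm_poly \<sigma> (p - q) = perm_poly \<sigma> p - perm_poly \<sigma> q"
  using perm_poly_add[of \<sigma> p "- q"] by (simp add: perm_poly_uminus)

lemma perm_poly_sum: "perm_poly \<sigma> (\<Sum>i\<in>A. f i) = (\<Sum>i\<in>A. perm_poly \<sigma> (f i))"
  by (induction A rule: infinite_finite_induct) (simp_all add: perm_poly_add)

lemma VG_cong_perm:
  "\<sigma> permutes {1..n+1} \<Longrightarrow> VG_cong n p q \<Longrightarrow> VG_cong n (perm_poly \<sigma> p) (perm_poly \<sigma> q)"
  using VG_full_ideal_perm[of \<sigma> n "p - q"] by (simp add: VG_cong_def perm_poly_diff)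

lemma VG_cong_xvar_square:
  assumes "i \<in> {1..n+1}" "j \<in> {1..n+1}" "i \<noteq> j"
  shows "VG_cong n (xvar i j ^ 2) 0"
proof -
  have "xvar i j ^ 2 \<in> VG_relations n"
    unfolding VG_relations_def using assms by blast
  then show ?thesis by (simp add: VG_cong_def VG_full_ideal_relation)
qed

lemma VG_cong_xvar_swap:
  assumes "i \<in> {1..n+1}" "j \<in> {1..n+1}" "i \<noteq> j"
  shows "VG_cong n (xvar i j) (- xvar j i)"
proof -
  have "xvar i j + xvar j i \<in> VG_relations n"
    unfolding VG_relations_def using assms by blast
  then show ?thesis by (simp add: VG_cong_def VG_full_ideal_relation)
qed

text \<open>The three-term relation solved for a product of two variables ending in
  \<open>k\<close>. The result is linear in such variables, with coefficient \<open>xvar i j\<close>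
  free of \<open>k\<close>; Lagrange's identity and the module decomposition both rest on this
  form.\<close>

lemma VG_cong_xvar_triple:
  assumes "i \<in> {1..n+1}" "j \<in> {1..n+1}" "k \<in> {1..n+1}" "i \<noteq> j" "j \<noteq> k" "i \<noteq> k"
  shows "VG_cong n (xvar i k * xvar j k) (xvar i j * (xvar j k - xvar i k))"
proof -
  have "xvar i j * xvar j k + xvar j k * xvar k i + xvar k i * xvar i j \<in> VG_relations n"
    unfolding VG_relations_def using assms by blast
  then have "VG_cong n 0 (xvar i j * xvar j k + (xvar j k + xvar i j) * xvar k i)"
    by - (rule VG_cong_sym, simp add: VG_cong_def VG_full_ideal_relation algebra_simps)
  also have "VG_cong n \<dots> (xvar i j * xvar j k + (xvar j k + xvar i j) * (- xvar i k))"
    using assms by (intro VG_cong_add VG_cong_refl VG_cong_mult_left VG_cong_xvar_swap) auto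
  finally have "VG_cong n (xvar i k * xvar j k + 0) (xvar i k * xvar j k +
      (xvar i j * xvar j k + (xvar j k + xvar i j) * (- xvar i k)))"
    by (intro VG_cong_add VG_cong_refl)
  then show ?thesis by (simp add: algebra_simps)
qed

subsection \<open>Powers of star sums and Lagrange's identity\<close>

definition elem_sym :: "nat \<Rightarrow> ('b \<Rightarrow> 'a::comm_ring_1) \<Rightarrow> 'b set \<Rightarrow> 'a"
  where "elem_sym k f A = (\<Sum>S | S \<subseteq> A \<and> card S = k. \<Prod>i\<in>S. f i)"

lemma elem_sym_0: "finite A \<Longrightarrow> elem_sym 0 f A = 1"
proof -
  assume "finite A"
  then have "{S. S \<subseteq> A \<and> card S = 0} = {{}}"
    by (auto dest: finite_subset)
  then show ?thesis by (simp add: elem_sym_def)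
qed

lemma elem_sym_Suc_insert:
  assumes "finite A" "a \<notin> A"
  shows "elem_sym (Suc k) f (insert a A) = elem_sym (Suc k) f A + f a * elem_sym k f A"
proof -
  let ?B = "{S. S \<subseteq> A \<and> card S = Suc k}" and ?C = "{S. S \<subseteq> A \<and> card S = k}"
  have fin: "finite S" "a \<notin> S" if "S \<subseteq> A" for S
    using that assms finite_subset by auto
  have "{S. S \<subseteq> insert a A \<and> card S = Suc k} = ?B \<union> insert a ` ?C"
  proof (intro equalityI subsetI)
    fix S assume S: "S \<in> {S. S \<subseteq> insert a A \<and> card S = Suc k}"
    show "S \<in> ?B \<union> insert a ` ?C"
    proof (cases "a \<in> S")
      case True
      with S have "S = insert a (S - {a})" "S - {a} \<in> ?C" by auto
      then show ?thesis by blast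
    qed (use S in auto)
  qed (use fin in auto)
  moreover have "inj_on (insert a) ?C"
    using fin(2) by (intro inj_onI) (metis (mono_tags, lifting) insert_ident mem_Collect_eq)
  moreover have "?B \<inter> insert a ` ?C = {}" using fin(2) by auto
  moreover have "finite ?B" "finite ?C" using assms(1) by auto
  ultimately show ?thesis
    using fin by (simp add: elem_sym_def sum.union_disjoint sum.reindex sum_distrib_left)
qed

lemma elem_sym_card: "finite A \<Longrightarrow> elem_sym (card A) f A = (\<Prod>i\<in>A. f i)"
proof -
  assume "finite A"
  then have "{S. S \<subseteq> A \<and> card S = card A} = {A}"
    by (auto dest: card_subset_eq)
  then show ?thesis by (simp add: elem_sym_def)
qed

lemma elem_sym_gt_card:
  assumes "finite A" "card A < k"
  shows "elem_sym k f A = 0"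
proof -
  have "{S. S \<subseteq> A \<and> card S = k} = {}"
    using assms by (auto dest: card_mono)
  then show ?thesis by (simp only: elem_sym_def sum.empty)
qed

text \<open>Double counting: a point \<open>r\<close> with a \<open>k\<close>-subset avoiding it is
  the same datum as a \<open>Suc k\<close>-subset \<open>T\<close> with a chosen point
  \<open>r\<close> in it.\<close>

lemma sum_pointed_subsets:
  assumes "finite A"
  shows "(\<Sum>r\<in>A. \<Sum>S | S \<subseteq> A - {r} \<and> card S = k. f r S) =
    (\<Sum>T | T \<subseteq> A \<and> card T = Suc k. \<Sum>r\<in>T. f r (T - {r}))"
proof -
  have fin: "finite {S. S \<subseteq> B \<and> card S = j}" if "B \<subseteq> A" for B j
    by (rule finite_subset[of _ "Pow A"]) (use that assms in auto)
  have fin': "finite S" if "S \<subseteq> A" for S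
    using that assms finite_subset by auto
  have "(\<Sum>r\<in>A. \<Sum>S | S \<subseteq> A - {r} \<and> card S = k. f r S) =
      (\<Sum>(r, S)\<in>Sigma A (\<lambda>r. {S. S \<subseteq> A - {r} \<and> card S = k}). f r S)"
    using assms fin by (subst sum.Sigma) auto
  also have "\<dots> = (\<Sum>(T, r)\<in>Sigma {T. T \<subseteq> A \<and> card T = Suc k} (\<lambda>T. T). f r (T - {r}))"
  proof (rule sum.reindex_bij_witness[where j = "\<lambda>(r, S). (insert r S, r)"
        and i = "\<lambda>(T, r). (r, T - {r})"])
    fix x assume "x \<in> Sigma A (\<lambda>r. {S. S \<subseteq> A - {r} \<and> card S = k})"
    then obtain r S where x: "x = (r, S)" "r \<in> A" "S \<subseteq> A" "r \<notin> S" "card S = k" by auto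
    with fin'[of S] show "(\<lambda>(T, r). (r, T - {r})) ((\<lambda>(r, S). (insert r S, r)) x) = x"
      "(\<lambda>(r, S). (insert r S, r)) x \<in> Sigma {T. T \<subseteq> A \<and> card T = Suc k} (\<lambda>T. T)"
      "(case (\<lambda>(r, S). (insert r S, r)) x of (T, r) \<Rightarrow> f r (T - {r})) = (case x of (r, S) \<Rightarrow> f r S)"
      by auto
  qed auto
  also have "\<dots> = (\<Sum>T | T \<subseteq> A \<and> card T = Suc k. \<Sum>r\<in>T. f r (T - {r}))"
    using fin fin' by (subst sum.Sigma) auto
  finally show ?thesis .
qed

text \<open>The binomial theorem, truncated after the term linear in \<open>a\<close>.\<close>

lemma VG_cong_power_add_square_zero:
  assumes "VG_cong n (a ^ 2) 0"
  shows "VG_cong n ((a + s) ^ Suc k) (s ^ Suc k + of_nat (Suc k) * a * s ^ k)"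
proof (induction k)
  case (Suc k)
  let ?K = "of_nat (Suc k) :: mpoly_rat"
  have "VG_cong n ((a + s) ^ Suc (Suc k)) ((a + s) * (s ^ Suc k + ?K * a * s ^ k))"
    using VG_cong_mult_left[OF Suc.IH, of "a + s"] by simp
  also have "(a + s) * (s ^ Suc k + ?K * a * s ^ k) =
      (s ^ Suc (Suc k) + (?K + 1) * a * s ^ Suc k) + ?K * s ^ k * a ^ 2"
    by (simp add: algebra_simps power2_eq_square)
  also have "VG_cong n \<dots> ((s ^ Suc (Suc k) + (?K + 1) * a * s ^ Suc k) + ?K * s ^ k * 0)"
    by (intro VG_cong_add VG_cong_refl VG_cong_mult_left assms)
  finally show ?case by (simp add: algebra_simps)
qed (simp add: add.commute)

text \<open>Splitting off one square-zero summand at a time, the truncated binomial formula matches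
  the recursion \<open>elem_sym_Suc_insert\<close>, because \<open>fact (Suc j)\<close> is
  \<open>Suc j * fact j\<close>.\<close>

lemma VG_cong_sum_power_elem_sym:
  assumes "finite A" "\<And>i. i \<in> A \<Longrightarrow> VG_cong n (f i ^ 2) 0"
  shows "VG_cong n ((\<Sum>i\<in>A. f i) ^ k) (of_nat (fact k) * elem_sym k f A)"
  using assms
proof (induction A arbitrary: k rule: finite_induct)
  case empty
  show ?case
    by (cases k) (auto simp: elem_sym_0 elem_sym_gt_card)
next
  case (insert a A)
  show ?case
  proof (cases k)
    case 0
    then show ?thesis using insert.hyps by (simp add: elem_sym_0)
  next
    case (Suc j)
    let ?s = "\<Sum>i\<in>A. f i"
    have IH: "VG_cong n (?s ^ i) (of_nat (fact i) * elem_sym i f A)" for i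
      using insert by blast
    have "VG_cong n ((f a + ?s) ^ Suc j) (?s ^ Suc j + of_nat (Suc j) * f a * ?s ^ j)"
      using insert.prems by (intro VG_cong_power_add_square_zero) auto
    also have "VG_cong n \<dots> (of_nat (fact (Suc j)) * elem_sym (Suc j) f A +
        of_nat (Suc j) * f a * (of_nat (fact j) * elem_sym j f A))"
      by (intro VG_cong_add VG_cong_mult_left IH)
    also have "\<dots> = of_nat (fact (Suc j)) * elem_sym (Suc j) f (insert a A)"
      using insert.hyps by (simp add: elem_sym_Suc_insert algebra_simps)
    finally show ?thesis using insert.hyps Suc by simp
  qed
qed

text \<open>The analogue of Lagrange's identity \<open>\<Sum>\<^sub>r \<Prod>\<^bsub>j\<noteq>r\<^esub> 1 / (t\<^sub>j - t\<^sub>r) = 0\<close>: the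
  elements \<open>1 / (t\<^sub>i - t\<^sub>j)\<close> satisfy the last two families of relations of \<open>VG\<^sub>n\<close>.\<close>

lemma VG_cong_Lagrange:
  assumes "S \<subseteq> {1..n+1}" "card S = Suc k"
  shows "VG_cong n (\<Sum>r\<in>S. \<Prod>j\<in>S-{r}. xvar j r) (if k = 0 then 1 else 0)"
  using assms
proof (induction k arbitrary: S)
  case 0
  then obtain a where "S = {a}" by (auto simp: card_1_singleton_iff)
  then show ?case by simp
next
  case (Suc k)
  let ?L = "\<lambda>S. \<Sum>r\<in>S. \<Prod>j\<in>S-{r}. xvar j r"
  obtain a S' where S': "S = insert a S'" "a \<notin> S'" "card S' = Suc k"
    using Suc.prems(2) card_Suc_eq by metis
  then obtain b T where T: "S' = insert b T" "b \<notin> T" "card T = k"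
    using card_Suc_eq by metis
  have S: "S = insert a (insert b T)" "a \<noteq> b" "a \<notin> T" "b \<notin> T"
    using S' T by auto
  have fin: "finite T" using Suc.prems(1) S(1) by (auto intro: finite_subset)
  have mem: "a \<in> {1..n+1}" "b \<in> {1..n+1}" "r \<in> T \<Longrightarrow> r \<in> {1..n+1}" for r
    using Suc.prems(1) S(1) by auto
  \<comment> \<open>\<open>P c r\<close> is the \<open>r\<close>-th summand of the identity for
    \<open>insert c T\<close>. The sets for \<open>c = a\<close> and \<open>c = b\<close> have one
    element less than \<open>S\<close>, so the induction hypothesis covers both.\<close>
  define P where "P c r = (\<Prod>j\<in>insert c T - {r}. xvar j r)" for c r
  have P: "P c r = xvar c r * (\<Prod>j\<in>T-{r}. xvar j r)" if "r \<in> T" "c \<notin> T" for c r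
  proof -
    have "insert c T - {r} = insert c (T - {r})" using that by auto
    then show ?thesis using that fin by (simp add: P_def)
  qed
  \<comment> \<open>The three-term relation replaces \<open>xvar a r * xvar b r\<close>, turning the
    summand of \<open>S\<close> into \<open>xvar a b\<close> times a difference of summands of the
    two smaller sets.\<close>
  have "VG_cong n (\<Prod>j\<in>S-{r}. xvar j r) (xvar a b * (P b r - P a r))" if "r \<in> T" for r
  proof -
    let ?Q = "\<Prod>j\<in>T-{r}. xvar j r"
    have "S - {r} = insert a (insert b (T - {r}))" using S that by auto
    then have "(\<Prod>j\<in>S-{r}. xvar j r) = ?Q * (xvar a r * xvar b r)"
      using S fin by (simp add: algebra_simps)
    also have "VG_cong n \<dots> (?Q * (xvar a b * (xvar b r - xvar a r)))"
      using S that mem by (intro VG_cong_mult_left VG_cong_xvar_triple) auto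
    also have "\<dots> = xvar a b * (P b r - P a r)"
      using P[of r] S that by (simp add: algebra_simps)
    finally show ?thesis .
  qed
  then have "VG_cong n (\<Sum>r\<in>T. \<Prod>j\<in>S-{r}. xvar j r) (\<Sum>r\<in>T. xvar a b * (P b r - P a r))"
    by (rule VG_cong_sum)
  moreover have "VG_cong n (\<Prod>j\<in>S-{a}. xvar j a) (- xvar a b * P a a)"
  proof -
    have "S - {a} = insert b T" "insert a T - {a} = T" using S by auto
    then have "(\<Prod>j\<in>S-{a}. xvar j a) = P a a * xvar b a"
      using S fin by (simp add: P_def)
    also have "VG_cong n \<dots> (P a a * (- xvar a b))"
      using S mem by (intro VG_cong_mult_left VG_cong_xvar_swap) auto
    finally show ?thesis by (simp add: mult.commute)
  qed
  moreover have "(\<Prod>j\<in>S-{b}. xvar j b) = xvar a b * P b b"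
  proof -
    have "S - {b} = insert a T" "insert b T - {b} = T" using S by auto
    then show ?thesis using S fin by (simp add: P_def)
  qed
  moreover have "?L S = (\<Sum>r\<in>T. \<Prod>j\<in>S-{r}. xvar j r) +
      ((\<Prod>j\<in>S-{a}. xvar j a) + (\<Prod>j\<in>S-{b}. xvar j b))"
  proof -
    have "sum f S = f a + (f b + sum f T)" for f :: "nat \<Rightarrow> mpoly_rat"
      using S fin by simp
    then show ?thesis by (simp only: add_ac)
  qed
  ultimately have "VG_cong n (?L S) ((\<Sum>r\<in>T. xvar a b * (P b r - P a r)) +
      (- xvar a b * P a a + xvar a b * P b b))"
    by (simp only: VG_cong_add VG_cong_refl)
  also have "\<dots> = xvar a b * (?L (insert b T) - ?L (insert a T))"
    using S fin
    by (simp add: P_def[symmetric] sum_subtractf sum_distrib_left[symmetric] algebra_simps)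
  \<comment> \<open>Both smaller sums are congruent to the same constant, which is 1 if
    \<open>k = 0\<close> and 0 otherwise, so their difference vanishes in either case.\<close>
  also have "VG_cong n \<dots> (xvar a b * ((if k = 0 then 1 else 0) - (if k = 0 then 1 else 0)))"
  proof (intro VG_cong_mult_left VG_cong_diff Suc.IH)
    show "insert b T \<subseteq> {1..n+1}" "insert a T \<subseteq> {1..n+1}" using mem by auto
    show "card (insert b T) = Suc k" "card (insert a T) = Suc k" using S fin T(3) by auto
  qed
  finally show ?case by simp
qed

text \<open>One formula covers two roles: for \<open>r\<close> in \<open>{1..n}\<close> it is the
  star centred at \<open>r\<close> among the first \<open>n\<close> indices, and for
  \<open>r = n+1\<close> the removal is void and it is the invariant generator.\<close>

definition star_sum :: "nat \<Rightarrow> nat \<Rightarrow> mpoly_rat"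
  where "star_sum n r = (\<Sum>j\<in>{1..n}-{r}. xvar j r)"

lemma star_sum_top: "star_sum n (n+1) = (\<Sum>j\<in>{1..n}. xvar j (n+1))"
  by (simp add: star_sum_def)

lemma VG_cong_star_sum_power:
  assumes "r \<in> {1..n+1}"
  shows "VG_cong n (star_sum n r ^ k) (of_nat (fact k) * elem_sym k (\<lambda>j. xvar j r) ({1..n}-{r}))"
  unfolding star_sum_def using assms
  by (intro VG_cong_sum_power_elem_sym VG_cong_xvar_square) auto

lemma VG_cong_star_sum_top_power_Suc: "VG_cong n (star_sum n (n+1) ^ (n+1)) 0"
proof -
  have "elem_sym (n+1) (\<lambda>j. xvar j (n+1)) ({1..n}-{n+1}) = 0"
    by (rule elem_sym_gt_card) auto
  with VG_cong_star_sum_power[of "n+1" n "n+1"] show ?thesis by simp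
qed

lemma VG_cong_star_sum_top_power:
  "VG_cong n (star_sum n (n+1) ^ n) (of_nat (fact n) * (\<Prod>j\<in>{1..n}. xvar j (n+1)))"
proof -
  have "{1..n}-{n+1} = {1..n}" by auto
  then have "elem_sym n (\<lambda>j. xvar j (n+1)) ({1..n}-{n+1}) = (\<Prod>j\<in>{1..n}. xvar j (n+1))"
    using elem_sym_card[of "{1..n}" "\<lambda>j. xvar j (n+1)"] by simp
  with VG_cong_star_sum_power[of "n+1" n n] show ?thesis by simp
qed

text \<open>Grouping the terms by \<open>T = insert r S\<close> produces sums of Lagrange type. The
  weight \<open>g\<close> stays arbitrary so that the weights 1 and \<open>xvar r (n+1)\<close> can
  both be inserted.\<close>

lemma sum_star_sum_power:
  "VG_cong n (\<Sum>r\<in>{1..n}. g r * star_sum n r ^ k)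
    (of_nat (fact k) * (\<Sum>T | T \<subseteq> {1..n} \<and> card T = Suc k.
      \<Sum>r\<in>T. g r * (\<Prod>j\<in>T-{r}. xvar j r)))"
proof -
  have "VG_cong n (\<Sum>r\<in>{1..n}. g r * star_sum n r ^ k)
      (\<Sum>r\<in>{1..n}. g r * (of_nat (fact k) * elem_sym k (\<lambda>j. xvar j r) ({1..n}-{r})))"
    by (intro VG_cong_sum VG_cong_mult_left VG_cong_star_sum_power) auto
  also have "\<dots> = of_nat (fact k) * (\<Sum>r\<in>{1..n}. \<Sum>S | S \<subseteq> {1..n} - {r} \<and> card S = k.
      g r * (\<Prod>j\<in>S. xvar j r))"
    by (simp add: elem_sym_def sum_distrib_left mult_ac)
  finally show ?thesis
    by (simp add: sum_pointed_subsets[where f = "\<lambda>r S. g r * (\<Prod>j\<in>S. xvar j r)"])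
qed

text \<open>The condition \<open>k > 0\<close> gives each \<open>T\<close> at least two elements, so
  every inner sum vanishes by Lagrange's identity.\<close>

lemma VG_cong_sum_star_sum_power:
  assumes "k > 0"
  shows "VG_cong n (\<Sum>r\<in>{1..n}. star_sum n r ^ k) 0"
proof -
  have "VG_cong n (\<Sum>r\<in>{1..n}. star_sum n r ^ k)
      (of_nat (fact k) * (\<Sum>T | T \<subseteq> {1..n} \<and> card T = Suc k. \<Sum>r\<in>T. \<Prod>j\<in>T-{r}. xvar j r))"
    using sum_star_sum_power[of n "\<lambda>_. 1" k] by simp
  also have "VG_cong n \<dots> (of_nat (fact k) * (\<Sum>T | T \<subseteq> {1..n} \<and> card T = Suc k. 0))"
  proof (intro VG_cong_mult_left VG_cong_sum)
    fix T assume T: "T \<in> {T. T \<subseteq> {1..n} \<and> card T = Suc k}"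
    then have "T \<subseteq> {1..n+1}" by auto
    with T show "VG_cong n (\<Sum>r\<in>T. \<Prod>j\<in>T-{r}. xvar j r) 0"
      using VG_cong_Lagrange[of T n k] assms by auto
  qed
  finally show ?thesis by simp
qed

text \<open>Lagrange's identity for \<open>insert (n+1) T\<close> equates the weighted inner sum
  over \<open>T\<close> with the summand at \<open>n+1\<close>, the product of all
  \<open>xvar j (n+1)\<close> over \<open>T\<close>. Summing over \<open>T\<close> gives an
  elementary symmetric sum of degree \<open>Suc k\<close>; the rational factor compares
  \<open>fact k\<close> with \<open>fact (Suc k)\<close>.\<close>

lemma VG_cong_sum_xvar_star_sum_power:
  "VG_cong n (\<Sum>r\<in>{1..n}. xvar r (n+1) * star_sum n r ^ k)
    (mconst (1 / of_nat (Suc k)) * star_sum n (n+1) ^ Suc k)"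
proof -
  let ?E = "elem_sym (Suc k) (\<lambda>j. xvar j (n+1)) {1..n}"
  have "VG_cong n (\<Sum>r\<in>{1..n}. xvar r (n+1) * star_sum n r ^ k)
      (of_nat (fact k) * (\<Sum>T | T \<subseteq> {1..n} \<and> card T = Suc k.
        \<Sum>r\<in>T. xvar r (n+1) * (\<Prod>j\<in>T-{r}. xvar j r)))"
    by (rule sum_star_sum_power)
  also have "VG_cong n \<dots> (of_nat (fact k) * ?E)"
    unfolding elem_sym_def
  proof (intro VG_cong_mult_left VG_cong_sum)
    fix T assume "T \<in> {T. T \<subseteq> {1..n} \<and> card T = Suc k}"
    then have T: "T \<subseteq> {1..n}" "card T = Suc k" by auto
    have fin: "finite T" and nT: "n+1 \<notin> T" using T by (auto intro: finite_subset)
    let ?P = "\<lambda>r. \<Prod>j\<in>T-{r}. xvar j r"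
    have "VG_cong n (\<Sum>r\<in>insert (n+1) T. \<Prod>j\<in>insert (n+1) T-{r}. xvar j r) 0"
      using VG_cong_Lagrange[of "insert (n+1) T" n "Suc k"] T fin nT by force
    also have "(\<Sum>r\<in>insert (n+1) T. \<Prod>j\<in>insert (n+1) T-{r}. xvar j r) =
        (\<Prod>j\<in>T. xvar j (n+1)) + (\<Sum>r\<in>T. ?P r * xvar (n+1) r)"
    proof -
      have "insert (n+1) T - {n+1} = T" using nT by auto
      moreover have "(\<Prod>j\<in>insert (n+1) T-{r}. xvar j r) = ?P r * xvar (n+1) r" if "r \<in> T" for r
      proof -
        have "insert (n+1) T - {r} = insert (n+1) (T - {r})" using nT that by auto
        then show ?thesis using nT fin by (simp add: mult.commute)
      qed
      ultimately show ?thesis using nT fin by simp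
    qed
    finally have 1: "VG_cong n ((\<Prod>j\<in>T. xvar j (n+1)) + (\<Sum>r\<in>T. ?P r * xvar (n+1) r)) 0" .
    have "VG_cong n (\<Sum>r\<in>T. xvar r (n+1) * ?P r) (- (\<Sum>r\<in>T. ?P r * xvar (n+1) r))"
      unfolding sum_negf[symmetric]
    proof (rule VG_cong_sum)
      fix r assume "r \<in> T"
      then have "VG_cong n (?P r * xvar r (n+1)) (?P r * (- xvar (n+1) r))"
        using T nT by (intro VG_cong_mult_left VG_cong_xvar_swap) auto
      then show "VG_cong n (xvar r (n+1) * ?P r) (- (?P r * xvar (n+1) r))"
        by (simp add: mult.commute)
    qed
    from VG_cong_add[OF this VG_cong_sym[OF 1]]
    show "VG_cong n (\<Sum>r\<in>T. xvar r (n+1) * ?P r) (\<Prod>j\<in>T. xvar j (n+1))" by simp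
  qed
  also have "of_nat (fact k) * ?E =
      mconst (1 / of_nat (Suc k)) * (of_nat (fact (Suc k)) * ?E)"
  proof -
    have "of_nat (fact k) = (1 / of_nat (Suc k)) * (of_nat (fact (Suc k)) :: rat)"
      by (simp add: field_simps del: of_nat_Suc) (simp add: algebra_simps)
    then show ?thesis
      by (simp only: of_nat_eq_mconst mconst_simps mult.assoc)
  qed
  also have "VG_cong n \<dots> (mconst (1 / of_nat (Suc k)) * star_sum n (n+1) ^ Suc k)"
  proof (rule VG_cong_mult_left[OF VG_cong_sym])
    have "{1..n} - {n+1} = {1..n}" by auto
    then show "VG_cong n (star_sum n (n+1) ^ Suc k) (of_nat (fact (Suc k)) * ?E)"
      using VG_cong_star_sum_power[of "n+1" n "Suc k"] by simp
  qed
  finally show ?thesis .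
qed

subsection \<open>Symmetrization\<close>

definition eval_at :: "mpoly_rat \<Rightarrow> rat poly \<Rightarrow> mpoly_rat"
  where "eval_at x q = poly (map_poly mconst q) x"

lemma eval_at_0 [simp]: "eval_at x 0 = 0"
  by (simp add: eval_at_def)

lemma eval_at_pCons: "eval_at x (pCons c q) = mconst c + x * eval_at x q"
  by (simp add: eval_at_def map_poly_pCons mconst_simps)

lemma eval_at_1 [simp]: "eval_at x 1 = 1"
  by (simp add: one_pCons eval_at_pCons mconst_simps)

lemma eval_at_add: "eval_at x (p + q) = eval_at x p + eval_at x q"
  by (induction p q rule: poly_induct2) (simp_all add: eval_at_pCons mconst_simps algebra_simps)

lemma eval_at_smult: "eval_at x (smult c q) = mconst c * eval_at x q"
  by (induction q) (simp_all add: eval_at_pCons mconst_simps algebra_simps)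

lemma eval_at_mult: "eval_at x (p * q) = eval_at x p * eval_at x q"
  by (induction p)
    (simp_all add: eval_at_pCons eval_at_add eval_at_smult mconst_simps algebra_simps)

lemma eval_at_X_power: "eval_at x ([:0, 1:] ^ k) = x ^ k"
  by (induction k) (simp_all add: eval_at_mult eval_at_pCons mconst_simps)

lemma perm_poly_eval_at: "perm_poly \<sigma> (eval_at x q) = eval_at (perm_poly \<sigma> x) q"
  by (induction q) (simp_all add: eval_at_pCons perm_poly_add perm_poly_mult)

lemma eval_at_closed:
  "x \<in> carrier (poly_ring n) \<Longrightarrow> eval_at x q \<in> carrier (poly_ring n)"
  by (induction q) (auto simp: eval_at_pCons intro!: poly_ring_closed(1,2) mconst_closed poly_ring_0_1)

text \<open>Membership of the class of \<open>p\<close> in the subalgebra generated by the star sum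
  at \<open>n+1\<close>.\<close>

definition star_poly :: "nat \<Rightarrow> mpoly_rat \<Rightarrow> bool"
  where "star_poly n p \<longleftrightarrow> (\<exists>q. VG_cong n p (eval_at (star_sum n (n+1)) q))"

lemma star_poly_cong: "VG_cong n p p' \<Longrightarrow> star_poly n p' \<Longrightarrow> star_poly n p"
  unfolding star_poly_def using VG_cong_trans by blast

lemma star_poly_add: "star_poly n p \<Longrightarrow> star_poly n p' \<Longrightarrow> star_poly n (p + p')"
  unfolding star_poly_def by (metis VG_cong_add eval_at_add)

lemma star_poly_scale: "star_poly n p \<Longrightarrow> star_poly n (mconst c * p)"
  unfolding star_poly_def by (metis VG_cong_mult_left eval_at_smult)

lemma star_poly_power: "star_poly n (star_sum n (n+1) ^ k)"
  unfolding star_poly_def by (metis VG_cong_refl eval_at_X_power)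

lemma star_poly_mconst: "star_poly n (mconst c)"
  using star_poly_scale[OF star_poly_power[of n 0]] by simp

lemma star_poly_sum: "(\<And>i. i \<in> A \<Longrightarrow> star_poly n (f i)) \<Longrightarrow> star_poly n (\<Sum>i\<in>A. f i)"
  using star_poly_mconst[of n 0]
  by (induction A rule: infinite_finite_induct) (auto simp: mconst_simps intro: star_poly_add)

text \<open>Reduces polynomials to monomials. Induction along Horner's scheme moves a factor
  \<open>s r\<close> into the weight, which is why \<open>g\<close> has to be generalized.\<close>

lemma star_poly_sum_eval_at:
  assumes "\<And>k. star_poly n (\<Sum>r\<in>A. g r * s r ^ k)"
  shows "star_poly n (\<Sum>r\<in>A. g r * eval_at (s r) q)"
  using assms
proof (induction q arbitrary: g)
  case 0
  show ?case using star_poly_mconst[of n 0] by (simp add: mconst_simps)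
next
  case (pCons c q)
  have "star_poly n (\<Sum>r\<in>A. g r * s r * s r ^ k)" for k
    using pCons.prems[of "Suc k"] by (simp add: mult.assoc)
  then have "star_poly n (\<Sum>r\<in>A. g r * s r * eval_at (s r) q)"
    by (rule pCons.IH)
  moreover have "star_poly n (mconst c * (\<Sum>r\<in>A. g r * s r ^ 0))"
    by (intro star_poly_scale pCons.prems)
  ultimately have "star_poly n (mconst c * (\<Sum>r\<in>A. g r * s r ^ 0) +
      (\<Sum>r\<in>A. g r * s r * eval_at (s r) q))"
    by (intro star_poly_add)
  then show ?case
    by (simp add: eval_at_pCons algebra_simps sum.distrib sum_distrib_left)
qed

text \<open>\<open>perm_poly id p\<close> is \<open>p\<close> written out as a sum of coefficients
  times products of variables, to which the closure properties apply directly.\<close>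

lemma poly_ring_induct [consumes 1, case_names mconst xvar add mult]:
  assumes "p \<in> carrier (poly_ring n)"
    and mconst: "\<And>c. P (mconst c)"
    and xvar: "\<And>i j. (i, j) \<in> var_ix n \<Longrightarrow> P (xvar i j)"
    and add: "\<And>p q. P p \<Longrightarrow> P q \<Longrightarrow> P (p + q)"
    and mult: "\<And>p q. P p \<Longrightarrow> P q \<Longrightarrow> P (p * q)"
  shows "P p"
proof -
  have P01: "P 0" "P 1" using mconst[of 0] mconst[of 1] by (simp_all add: mconst_simps)
  have sum: "P (\<Sum>i\<in>A. f i)" if "\<And>i. i \<in> A \<Longrightarrow> P (f i)" for A and f :: "monom_ix \<Rightarrow> mpoly_rat"
    using that by (induction A rule: infinite_finite_induct) (auto intro: P01 add)
  have prod: "P (\<Prod>i\<in>A. f i)" if "\<And>i. i \<in> A \<Longrightarrow> P (f i)"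
    for A and f :: "nat \<times> nat \<Rightarrow> mpoly_rat"
    using that by (induction A rule: infinite_finite_induct) (auto intro: P01 mult)
  have power: "P (q ^ k)" if "P q" for q k
    using that by (induction k) (auto intro: P01 mult)
  have "P (perm_poly id p)"
    unfolding perm_poly_def using assms(1)
    by (intro sum mult mconst prod) (auto simp: carrier_poly_ring intro!: power xvar)
  then show ?thesis by (simp add: perm_poly_id)
qed

text \<open>The set \<open>D\<close> of representable elements contains 1 and is stable under
  multiplication by every generator. Only products of two variables ending in
  \<open>Suc m + 1\<close> need reduction: equal ones vanish, and distinct ones become linear by the
  three-term relation.\<close>

lemma VG_module_decomposition:
  assumes "p \<in> carrier (poly_ring (Suc m))"
  obtains w v where "w \<in> carrier (poly_ring m)" "\<forall>i. v i \<in> carrier (poly_ring m)"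
    "VG_cong (Suc m) p (w + (\<Sum>i\<in>{1..Suc m}. xvar i (Suc m + 1) * v i))"
proof -
  let ?n = "Suc m"
  let ?C = "carrier (poly_ring m)"
  let ?y = "\<lambda>i. xvar i (?n + 1)"
  define D where "D p \<longleftrightarrow> (\<exists>w v. w \<in> ?C \<and> (\<forall>i. v i \<in> ?C) \<and>
    VG_cong ?n p (w + (\<Sum>i\<in>{1..?n}. ?y i * v i)))" for p
  have D_base: "D w" if "w \<in> ?C" for w
    unfolding D_def using that by (intro exI[of _ w] exI[of _ "\<lambda>_. 0"]) (auto simp: poly_ring_0_1)
  have D_y: "D (?y i * w)" if "i \<in> {1..?n}" "w \<in> ?C" for i w
  proof -
    have "(\<Sum>l\<in>{1..?n}. ?y l * (if l = i then w else 0)) = ?y i * w"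
      using that(1) by (simp add: if_distrib[of "(*) _"] cong: if_cong)
    then show ?thesis
      unfolding D_def using that(2)
      by (intro exI[of _ 0] exI[of _ "\<lambda>l. if l = i then w else 0"]) (auto simp: poly_ring_0_1)
  qed
  have D_add: "D (p + q)" if pq: "D p" "D q" for p q
  proof -
    from pq obtain w v w' v' where "w \<in> ?C" "\<forall>i. v i \<in> ?C" "w' \<in> ?C" "\<forall>i. v' i \<in> ?C"
      "VG_cong ?n p (w + (\<Sum>i\<in>{1..?n}. ?y i * v i))"
      "VG_cong ?n q (w' + (\<Sum>i\<in>{1..?n}. ?y i * v' i))"
      unfolding D_def by auto
    moreover from VG_cong_add[OF this(5,6)]
    have "VG_cong ?n (p + q) ((w + w') + (\<Sum>i\<in>{1..?n}. ?y i * (v i + v' i)))"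
      by (simp only: distrib_left sum.distrib add_ac)
    ultimately show ?thesis
      unfolding D_def by (intro exI[of _ "w + w'"] exI[of _ "\<lambda>i. v i + v' i"])
        (auto intro: poly_ring_closed(1))
  qed
  have D_cong: "D p" if "VG_cong ?n p q" "D q" for p q
    using that unfolding D_def by (meson VG_cong_trans)
  have D_sum: "D (\<Sum>i\<in>A. f i)" if "\<And>i. i \<in> A \<Longrightarrow> D (f i)" for A and f :: "nat \<Rightarrow> mpoly_rat"
    using that
    by (induction A rule: infinite_finite_induct) (auto intro: D_add D_base poly_ring_0_1)
  have D_scale: "D (x * q)" if "x \<in> ?C" "D q" for x q
  proof -
    from that obtain w v where wv: "w \<in> ?C" "\<forall>i. v i \<in> ?C"
      and *: "VG_cong ?n q (w + (\<Sum>i\<in>{1..?n}. ?y i * v i))"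
      unfolding D_def by auto
    have "D (x * w + (\<Sum>i\<in>{1..?n}. ?y i * (x * v i)))"
      using wv that by (intro D_add D_sum D_base D_y) (auto intro: poly_ring_closed(2))
    then have "D (x * (w + (\<Sum>i\<in>{1..?n}. ?y i * v i)))"
      by (simp add: distrib_left sum_distrib_left mult_ac)
    then show ?thesis by (rule D_cong[OF VG_cong_mult_left[OF *]])
  qed
  have xvar_C: "xvar i j \<in> ?C" if "i \<in> {1..?n}" "j \<in> {1..?n}" "i \<noteq> j" for i j
    using that by (intro xvar_closed) (auto simp: var_ix_def)
  have D_yy: "D (?y i * (?y l * v))" if "i \<in> {1..?n}" "l \<in> {1..?n}" "v \<in> ?C" for i l v
  proof (cases "i = l")
    case True
    have "VG_cong ?n (v * ?y i ^ 2) (v * 0)"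
      using that by (intro VG_cong_mult_left VG_cong_xvar_square) auto
    then have "VG_cong ?n (?y i * (?y l * v)) 0"
      by (simp add: True power2_eq_square mult_ac)
    then show ?thesis by (rule D_cong) (simp add: D_base poly_ring_0_1)
  next
    case False
    have "VG_cong ?n (v * (?y i * ?y l)) (v * (xvar i l * (?y l - ?y i)))"
      using that False by (intro VG_cong_mult_left VG_cong_xvar_triple) auto
    then have "VG_cong ?n (?y i * (?y l * v)) (?y l * (xvar i l * v) + ?y i * ((- xvar i l) * v))"
      by (simp add: algebra_simps)
    moreover have "D (?y l * (xvar i l * v) + ?y i * ((- xvar i l) * v))"
      using that False xvar_C[of i l]
      by (intro D_add D_y poly_ring_closed(2)) (simp_all add: poly_ring_closed(3))
    ultimately show ?thesis by (rule D_cong)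
  qed
  have D_y_mult: "D (?y i * q)" if "i \<in> {1..?n}" "D q" for i q
  proof -
    from that obtain w v where wv: "w \<in> ?C" "\<forall>i. v i \<in> ?C"
      and *: "VG_cong ?n q (w + (\<Sum>i\<in>{1..?n}. ?y i * v i))"
      unfolding D_def by auto
    have "D (?y i * w + (\<Sum>l\<in>{1..?n}. ?y i * (?y l * v l)))"
      using wv that by (intro D_add D_sum D_y D_yy) auto
    then have "D (?y i * (w + (\<Sum>i\<in>{1..?n}. ?y i * v i)))"
      by (simp add: distrib_left sum_distrib_left)
    then show ?thesis by (rule D_cong[OF VG_cong_mult_left[OF *]])
  qed
  \<comment> \<open>Stability under multiplication by \<open>p\<close> passes to sums and products
    of multipliers, so the induction need not show directly that \<open>D\<close> is closed under
    products.\<close>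
  have "\<forall>q. D q \<longrightarrow> D (p * q)"
    using assms
  proof (induction p rule: poly_ring_induct)
    case (mconst c)
    then show ?case using D_scale mconst_closed by blast
  next
    case (xvar i j)
    show ?case
    proof (intro allI impI)
      fix q assume q: "D q"
      from xvar consider "i \<in> {1..?n}" "j \<in> {1..?n}" "i \<noteq> j" | "i \<in> {1..?n}" "j = ?n + 1"
        | "i = ?n + 1" "j \<in> {1..?n}"
        unfolding var_ix_def by force
      then show "D (xvar i j * q)"
      proof cases
        case 1
        then show ?thesis using D_scale q xvar_C by blast
      next
        case 2
        then show ?thesis using D_y_mult q by blast
      next
        case 3
        then have "VG_cong ?n (q * xvar i j) (q * (- ?y j))"
          by (intro VG_cong_mult_left) (auto intro!: VG_cong_xvar_swap)
        then have *: "VG_cong ?n (xvar i j * q) (mconst (- 1) * (?y j * q))"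
          by (simp add: mconst_def single_uminus mult_ac)
        show ?thesis by (rule D_cong[OF *]) (intro D_scale mconst_closed D_y_mult 3 q)
      qed
    qed
  next
    case (add p q)
    then show ?case by (auto simp: distrib_right intro: D_add)
  next
    case (mult p q)
    then show ?case by (auto simp: mult.assoc)
  qed
  then have "D p" using D_base[OF poly_ring_0_1(2)] by (metis mult.right_neutral)
  then show thesis unfolding D_def using that by blast
qed

text \<open>Sum over the permutations fixing \<open>n+1\<close>, left unnormalized; the division by
  \<open>fact n\<close> happens once, when invariants are recovered.\<close>

definition symmetrize :: "nat \<Rightarrow> mpoly_rat \<Rightarrow> mpoly_rat"
  where "symmetrize n p = (\<Sum>\<sigma> | \<sigma> permutes {1..n}. perm_poly \<sigma> p)"

lemma permutes_Suc:
  fixes n :: nat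
  shows "\<sigma> permutes {1..n} \<Longrightarrow> \<sigma> permutes {1..n+1}"
  by (rule permutes_subset) auto

lemma symmetrize_add: "symmetrize n (p + q) = symmetrize n p + symmetrize n q"
  by (simp add: symmetrize_def perm_poly_add sum.distrib)

lemma symmetrize_0: "symmetrize n 0 = 0"
  by (simp add: symmetrize_def)

lemma symmetrize_sum: "symmetrize n (\<Sum>i\<in>A. f i) = (\<Sum>i\<in>A. symmetrize n (f i))"
  by (induction A rule: infinite_finite_induct) (simp_all add: symmetrize_add symmetrize_0)

lemma symmetrize_cong: "VG_cong n p q \<Longrightarrow> VG_cong n (symmetrize n p) (symmetrize n q)"
  unfolding symmetrize_def by (intro VG_cong_sum VG_cong_perm permutes_Suc) auto

lemma symmetrize_perm:
  "\<tau> permutes {1..n} \<Longrightarrow> symmetrize n (perm_poly \<tau> p) = symmetrize n p"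
  unfolding symmetrize_def perm_poly_comp
  by (rule sum_permutations_compose_right[symmetric])

text \<open>The transpositions of \<open>Suc m\<close> with \<open>r\<close> represent the cosets of
  the permutations of \<open>{1..m}\<close> in those of \<open>{1..Suc m}\<close>.\<close>

lemma symmetrize_Suc:
  "symmetrize (Suc m) p =
    (\<Sum>r\<in>{1..Suc m}. perm_poly (transpose (Suc m) r) (symmetrize m p))"
proof -
  have "{1..Suc m} = insert (Suc m) {1..m}" by auto
  then show ?thesis
    unfolding symmetrize_def
    using sum_over_permutations_insert[of "{1..m}" "Suc m" "\<lambda>\<sigma>. perm_poly \<sigma> p"]
    by (simp add: perm_poly_sum perm_poly_comp)
qed

lemma perm_poly_transpose_star_sum:
  assumes "r \<in> {1..Suc m}"
  shows "perm_poly (transpose (Suc m) r) (star_sum m (m+1)) = star_sum (Suc m) r"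
proof -
  let ?t = "transpose (Suc m) r"
  have "?t permutes {1..Suc m}" using assms by (intro permutes_swap_id) auto
  then have "?t ` ({1..Suc m} - {Suc m}) = {1..Suc m} - {r}"
    by (subst image_set_diff) (auto simp: permutes_inj permutes_image)
  moreover have "{1..Suc m} - {Suc m} = {1..m}" by auto
  ultimately have img: "?t ` {1..m} = {1..Suc m} - {r}" by simp
  have "star_sum (Suc m) r = (\<Sum>j\<in>{1..m}. xvar (?t j) r)"
    unfolding star_sum_def img[symmetric]
    by (subst sum.reindex) (auto intro: inj_on_subset[OF inj_transpose])
  then show ?thesis unfolding star_sum_top perm_poly_sum by simp
qed

text \<open>In the smaller ring the distinguished index is \<open>m+1\<close>, so the induction
  hypothesis handles the inner symmetrization over \<open>{1..m}\<close>; the coset transpositions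
  then move the centre of the star to every \<open>r\<close>.\<close>

lemma star_poly_symmetrize:
  "p \<in> carrier (poly_ring n) \<Longrightarrow> star_poly n (symmetrize n p)"
proof (induction n arbitrary: p)
  case 0
  \<comment> \<open>With the single index 1 there are no pairs of distinct indices, hence no
    variables.\<close>
  then have "\<exists>c. p = mconst c"
    by (induction p rule: poly_ring_induct) (auto simp: var_ix_def mconst_simps(3,4)[symmetric])
  moreover have "symmetrize 0 p = p"
    by (simp add: symmetrize_def perm_poly_id)
  ultimately show ?case using star_poly_mconst by auto
next
  case (Suc m)
  let ?n = "Suc m"
  let ?y = "\<lambda>i. xvar i (?n + 1)"
  \<comment> \<open>Treats both kinds of module generators at once: \<open>g\<close> is constantly 1
    or \<open>?y\<close>. Its value at \<open>?n\<close> is fixed by the inner permutations, so it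
    can be pulled out of the inner symmetrization.\<close>
  have key: "star_poly ?n (symmetrize ?n (g ?n * w))"
    if w: "w \<in> carrier (poly_ring m)"
      and g: "\<And>\<sigma>. \<sigma> permutes {1..m} \<Longrightarrow> perm_poly \<sigma> (g ?n) = g ?n"
        "\<And>r. r \<in> {1..?n} \<Longrightarrow> perm_poly (transpose ?n r) (g ?n) = g r"
      and pow: "\<And>k. star_poly ?n (\<Sum>r\<in>{1..?n}. g r * star_sum ?n r ^ k)" for g w
  proof -
    obtain q where q: "VG_cong m (symmetrize m w) (eval_at (star_sum m (m+1)) q)"
      using Suc.IH[OF w] unfolding star_poly_def by blast
    have "symmetrize m (g ?n * w) = g ?n * symmetrize m w"
      by (simp add: symmetrize_def perm_poly_mult g(1) sum_distrib_left)
    then have "symmetrize ?n (g ?n * w) =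
        (\<Sum>r\<in>{1..?n}. g r * perm_poly (transpose ?n r) (symmetrize m w))"
      by (simp add: symmetrize_Suc perm_poly_mult g(2))
    also have "VG_cong ?n \<dots> (\<Sum>r\<in>{1..?n}. g r * eval_at (star_sum ?n r) q)"
    proof (intro VG_cong_sum VG_cong_mult_left)
      fix r assume r: "r \<in> {1..?n}"
      then have "transpose ?n r permutes {1..?n+1}" by (intro permutes_swap_id) auto
      moreover have "VG_cong ?n (symmetrize m w) (eval_at (star_sum m (m+1)) q)"
        using q by (rule VG_cong_mono) simp
      ultimately show "VG_cong ?n (perm_poly (transpose ?n r) (symmetrize m w))
          (eval_at (star_sum ?n r) q)"
        using VG_cong_perm[of "transpose ?n r" ?n]
        unfolding perm_poly_transpose_star_sum[OF r, symmetric] perm_poly_eval_at[symmetric]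
        by blast
    qed
    finally show ?thesis
      by (rule star_poly_cong) (rule star_poly_sum_eval_at[OF pow])
  qed
  obtain w v where w: "w \<in> carrier (poly_ring m)" and v: "\<forall>i. v i \<in> carrier (poly_ring m)"
    and p: "VG_cong ?n p (w + (\<Sum>i\<in>{1..?n}. ?y i * v i))"
    using VG_module_decomposition[OF Suc.prems] by blast
  have "star_poly ?n (symmetrize ?n (1 * w))"
  proof (rule key[where g = "\<lambda>_. 1"])
    fix k
    show "star_poly ?n (\<Sum>r\<in>{1..?n}. 1 * star_sum ?n r ^ k)"
    proof (cases "k = 0")
      case True
      then have "(\<Sum>r\<in>{1..?n}. 1 * star_sum ?n r ^ k) = mconst (of_nat ?n)"
        using of_nat_eq_mconst[of ?n] by simp
      then show ?thesis by (simp only: star_poly_mconst)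
    next
      case False
      then have "VG_cong ?n (\<Sum>r\<in>{1..?n}. 1 * star_sum ?n r ^ k) (mconst 0)"
        using VG_cong_sum_star_sum_power[of k ?n] by (simp add: mconst_simps)
      then show ?thesis by (rule star_poly_cong) (rule star_poly_mconst)
    qed
  qed (auto intro: w)
  moreover have "star_poly ?n (symmetrize ?n (?y i * v i))" if i: "i \<in> {1..?n}" for i
  proof -
    let ?t = "transpose ?n i"
    \<comment> \<open>The transposition replaces \<open>?y i\<close> by \<open>?y ?n\<close>. It
      permutes \<open>{1..m+1}\<close>, the index set of \<open>poly_ring m\<close>, so the
      transformed coefficient stays in that ring.\<close>
    have t: "?t permutes {1..m+1}" using i by (intro permutes_swap_id) auto
    have "symmetrize ?n (?y i * v i) = symmetrize ?n (perm_poly ?t (?y i * v i))"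
      using t by (intro symmetrize_perm[symmetric]) simp
    also have "perm_poly ?t (?y i * v i) = ?y ?n * perm_poly ?t (v i)"
      using i by (simp add: perm_poly_mult transpose_apply_other)
    finally have *: "symmetrize ?n (?y i * v i) = symmetrize ?n (?y ?n * perm_poly ?t (v i))" .
    show ?thesis
      unfolding *
    proof (rule key[where g = ?y])
      show "perm_poly ?t (v i) \<in> carrier (poly_ring m)"
        by (rule perm_poly_closed[OF t v[rule_format]])
      show "perm_poly \<sigma> (?y ?n) = ?y ?n" if "\<sigma> permutes {1..m}" for \<sigma>
        using that by (simp add: permutes_not_in)
      show "perm_poly (transpose ?n r) (?y ?n) = ?y r" if "r \<in> {1..?n}" for r
        using that by (simp add: transpose_apply_other)
      show "star_poly ?n (\<Sum>r\<in>{1..?n}. ?y r * star_sum ?n r ^ k)" for k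
        by (rule star_poly_cong[OF VG_cong_sum_xvar_star_sum_power])
          (intro star_poly_scale star_poly_power)
    qed
  qed
  ultimately have "star_poly ?n (symmetrize ?n (w + (\<Sum>i\<in>{1..?n}. ?y i * v i)))"
    unfolding symmetrize_add symmetrize_sum by (intro star_poly_add star_poly_sum) auto
  then show ?case by (rule star_poly_cong[OF symmetrize_cong[OF p]])
qed

subsection \<open>Nonvanishing and the isomorphism\<close>

text \<open>The monomial ideal generated by the squares of all variables. Membership is read off
  from the exponents, so nonmembership of a square-free monomial is immediate.\<close>

definition squares_ideal :: "mpoly_rat set"
  where "squares_ideal =
    {p. \<forall>m \<in> Poly_Mapping.keys p. \<exists>e. Poly_Mapping.lookup m e \<ge> 2}"

lemma squares_ideal_add: "p \<in> squares_ideal \<Longrightarrow> q \<in> squares_ideal \<Longrightarrow> p + q \<in> squares_ideal"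
  using Poly_Mapping.keys_add[of p q] unfolding squares_ideal_def by blast

lemma squares_ideal_mult: "p \<in> squares_ideal \<Longrightarrow> q * p \<in> squares_ideal"
  unfolding squares_ideal_def
proof safe
  fix m assume p: "\<forall>m \<in> Poly_Mapping.keys p. \<exists>e. Poly_Mapping.lookup m e \<ge> 2"
    and "m \<in> Poly_Mapping.keys (q * p)"
  then obtain a b where m: "m = a + b" "b \<in> Poly_Mapping.keys p"
    using keys_mult[of q p] by auto
  with p obtain e where "Poly_Mapping.lookup b e \<ge> 2" by blast
  then show "\<exists>e. Poly_Mapping.lookup m e \<ge> 2"
    by (intro exI[of _ e]) (simp add: m lookup_add)
qed

lemma xvar_square_in_squares_ideal: "xvar i j ^ 2 \<in> squares_ideal"
  by (auto simp: squares_ideal_def xvar_def power2_eq_square mult_single lookup_add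
      simp del: split_paired_Ex intro!: exI[of _ "(i, j)"])

text \<open>The diagonal variable \<open>x\<^bsub>ii\<^esub>\<close>, which does not occur in \<open>VG\<^sub>n\<close>, plays the role of \<open>a\<^sub>i\<close>.\<close>

definition min_subst :: "nat \<times> nat \<Rightarrow> mpoly_rat"
  where "min_subst = (\<lambda>(i, j). if i < j then xvar i i else - xvar j j)"

lemma mpoly_subst_min_relation:
  assumes "r \<in> VG_relations n"
  shows "mpoly_subst min_subst r \<in> squares_ideal"
proof -
  have sq: "c * xvar i i ^ 2 \<in> squares_ideal" for c i
    by (intro squares_ideal_mult xvar_square_in_squares_ideal)
  have sq': "xvar i i * xvar i i \<in> squares_ideal" "- (xvar i i * xvar i i) \<in> squares_ideal" for i
    using sq[of 1 i] sq[of "- 1" i] by (simp_all add: power2_eq_square)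
  have zero: "0 \<in> squares_ideal" by (simp add: squares_ideal_def)
  from assms consider
      i j where "r = xvar i j ^ 2"
    | i j where "r = xvar i j + xvar j i" "i \<noteq> j"
    | i j k where "r = xvar i j * xvar j k + xvar j k * xvar k i + xvar k i * xvar i j"
        "i \<noteq> j" "j \<noteq> k" "i \<noteq> k"
    unfolding VG_relations_def by blast
  then show ?thesis
  proof cases
    case 1
    then show ?thesis
      by (auto simp: power2_eq_square mpoly_subst_mult mpoly_subst_xvar min_subst_def sq')
  next
    case 2
    then show ?thesis
      by (auto simp: mpoly_subst_add mpoly_subst_xvar min_subst_def zero)
  next
    case 3
    \<comment> \<open>In each of the six orderings the mixed products cancel and only minus the
      square of the variable of the smallest index survives.\<close>
    then have "i < j \<and> j < k \<or> i < k \<and> k < j \<or> j < i \<and> i < k \<or> j < k \<and> k < i \<or>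
        k < i \<and> i < j \<or> k < j \<and> j < i"
      by linarith
    then show ?thesis
      unfolding 3(1) mpoly_subst_add mpoly_subst_mult mpoly_subst_xvar min_subst_def
      by (elim disjE conjE) (simp_all add: algebra_simps sq')
  qed
qed

lemma mpoly_subst_min_ideal:
  "p \<in> VG_full_ideal n \<Longrightarrow> mpoly_subst min_subst p \<in> squares_ideal"
proof (induction rule: VG_full_ideal.induct)
  case (gen r p)
  then show ?case by (simp add: mpoly_subst_mult squares_ideal_mult mpoly_subst_min_relation)
next
  case zero
  then show ?case by (simp add: mpoly_subst_0 squares_ideal_def)
qed (simp add: mpoly_subst_add squares_ideal_add)

lemma star_sum_top_power_nonzero: "\<not> VG_cong n (star_sum n (n+1) ^ n) 0"
proof
  let ?y = "\<Prod>j\<in>{1..n}. xvar j (n+1)"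
  assume "VG_cong n (star_sum n (n+1) ^ n) 0"
  from VG_cong_trans[OF VG_cong_sym[OF VG_cong_star_sum_top_power] this]
  have "mpoly_subst min_subst (mconst (of_nat (fact n)) * ?y) \<in> squares_ideal"
    unfolding of_nat_eq_mconst by (intro mpoly_subst_min_ideal) (simp add: VG_cong_def)
  then have "mconst (of_nat (fact n)) * mpoly_subst min_subst ?y \<in> squares_ideal"
    by (simp only: mpoly_subst_mult mpoly_subst_mconst)
  moreover have "mpoly_subst min_subst ?y = (\<Prod>j\<in>{1..n}. xvar j j)"
    by (simp add: mpoly_subst_prod mpoly_subst_xvar min_subst_def)
  moreover have "(\<Prod>j\<in>A. xvar j j) =
      Poly_Mapping.single (\<Sum>j\<in>A. Poly_Mapping.single (j, j) 1) 1" if "finite A" for A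
    using that by (induction A rule: finite_induct) (simp_all add: xvar_def mult_single)
  ultimately have "Poly_Mapping.single (\<Sum>j\<in>{1..n}. Poly_Mapping.single (j, j) 1) (of_nat (fact n))
      \<in> squares_ideal"
    by (simp add: mconst_def mult_single)
  then obtain e where "Poly_Mapping.lookup (\<Sum>j\<in>{1..n}. Poly_Mapping.single (j, j) (1::nat)) e \<ge> 2"
    unfolding squares_ideal_def by auto
  moreover have "Poly_Mapping.lookup (\<Sum>j\<in>{1..n}. Poly_Mapping.single (j, j) (1::nat)) e =
      (\<Sum>j\<in>{1..n}. if j = fst e \<and> fst e = snd e then 1 else 0)"
    unfolding lookup_sum by (cases e, intro sum.cong) (auto simp: lookup_single when_def)
  \<comment> \<open>The diagonal variables are distinct, so every exponent of their product is at
    most 1, against the exponent of at least 2 at \<open>e\<close>.\<close>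
  moreover have "\<dots> \<le> (\<Sum>j\<in>{1..n}. if j = fst e then 1 else 0)"
    by (intro sum_mono) auto
  moreover have "\<dots> \<le> 1" by simp
  ultimately show False by linarith
qed

text \<open>This determines the kernel of evaluation at the star sum: its power \<open>n+1\<close>
  vanishes and its power \<open>n\<close> does not.\<close>

lemma VG_cong_eval_at_star_sum_iff:
  "VG_cong n (eval_at (star_sum n (n+1)) q) 0 \<longleftrightarrow> [:0, 1:] ^ (n + 1) dvd q"
proof
  let ?z = "star_sum n (n+1)"
  assume "[:0, 1:] ^ (n + 1) dvd q"
  then obtain r where "q = [:0, 1:] ^ (n + 1) * r" by (elim dvdE)
  then have "eval_at ?z q = eval_at ?z r * ?z ^ (n + 1)"
    by (simp only: eval_at_mult eval_at_X_power mult.commute)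
  then show "VG_cong n (eval_at ?z q) 0"
    using VG_cong_mult_left[OF VG_cong_star_sum_top_power_Suc[of n], of "eval_at ?z r"] by simp
next
  let ?z = "star_sum n (n+1)"
  assume q0: "VG_cong n (eval_at ?z q) 0"
  show "[:0, 1:] ^ (n + 1) dvd q"
  proof (rule ccontr)
    assume ndvd: "\<not> [:0, 1:] ^ (n + 1) dvd q"
    then have "q \<noteq> 0" by auto
    \<comment> \<open>\<open>k\<close> is the order of \<open>q\<close> at 0, so \<open>r\<close>
      has nonzero constant term \<open>c\<close>.\<close>
    from order_decomp[OF this, of 0] obtain k r where
      q: "q = [:0, 1:] ^ k * r" and r: "\<not> [:0, 1:] dvd r" by auto
    have k: "k \<le> n"
    proof (rule ccontr)
      assume "\<not> k \<le> n"
      then have "[:0, 1:] ^ (n + 1) dvd ([:0, 1:] ^ k :: rat poly)" by (intro le_imp_power_dvd) simp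
      with ndvd q show False by (simp add: dvd_mult2)
    qed
    obtain c r' where r': "r = pCons c r'" by (rule pCons_cases)
    have c: "c \<noteq> 0"
    proof
      assume "c = 0"
      then have "r = [:0, 1:] * r'" by (simp add: r')
      then have "[:0, 1:] dvd r" by (rule dvdI)
      with r show False ..
    qed
    \<comment> \<open>Multiplying by the power \<open>n - k\<close> lifts the lowest term to
      \<open>mconst c * ?z ^ n\<close> and all others to multiples of \<open>?z ^ (n + 1)\<close>,
      which vanish.\<close>
    have "?z ^ (n - k) * eval_at ?z q = ?z ^ (n - k) * ?z ^ k * (mconst c + ?z * eval_at ?z r')"
      by (simp only: q r' eval_at_mult eval_at_X_power eval_at_pCons mult.assoc)
    also have "\<dots> = mconst c * ?z ^ n + eval_at ?z r' * ?z ^ (n + 1)"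
      using k by (simp add: power_add[symmetric] algebra_simps)
    finally have "mconst c * ?z ^ n =
        ?z ^ (n - k) * eval_at ?z q - eval_at ?z r' * ?z ^ (n + 1)" by simp
    also have "VG_cong n \<dots> (?z ^ (n - k) * 0 - eval_at ?z r' * 0)"
      by (intro VG_cong_diff VG_cong_mult_left q0 VG_cong_star_sum_top_power_Suc)
    finally have "VG_cong n (mconst (1 / c) * (mconst c * ?z ^ n)) (mconst (1 / c) * 0)"
      by (intro VG_cong_mult_left) simp
    moreover have "mconst (1 / c) * (mconst c * ?z ^ n) = ?z ^ n"
      using c by (simp add: mult.assoc[symmetric] mconst_simps(4)[symmetric] mconst_simps(2))
    ultimately show False using star_sum_top_power_nonzero[of n] by simp
  qed
qed

lemma perm_poly_star_sum_top:
  assumes "\<sigma> permutes {1..n}"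
  shows "perm_poly \<sigma> (star_sum n (n+1)) = star_sum n (n+1)"
proof -
  have "\<sigma> (n+1) = n+1" using assms by (rule permutes_not_in) simp
  then show ?thesis
    unfolding star_sum_top perm_poly_sum perm_poly_xvar
    using sum.permute[OF assms, of "\<lambda>j. xvar j (n+1)"] by (simp add: comp_def)
qed

lemma star_sum_top_closed: "star_sum n (n+1) \<in> carrier (poly_ring n)"
  unfolding star_sum_top by (intro poly_ring_sum_closed xvar_closed) (auto simp: var_ix_def)

text \<open>Translates the congruence, taken in all variables, back to cosets in
  \<open>poly_ring n\<close>: the difference lies in the carrier, where \<open>VG_ideal_eq\<close>
  applies.\<close>

lemma VG_coset_eq_iff:
  assumes "p \<in> carrier (poly_ring n)" "q \<in> carrier (poly_ring n)"
  shows "VG_ideal n +>\<^bsub>poly_ring n\<^esub> p = VG_ideal n +>\<^bsub>poly_ring n\<^esub> q \<longleftrightarrow> VG_cong n p q"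
proof -
  interpret R: cring "poly_ring n" by (rule cring_poly_ring)
  have "\<ominus>\<^bsub>poly_ring n\<^esub> q = - q"
    using assms by (intro R.minus_equality) (auto intro: poly_ring_closed(3))
  then have "p \<ominus>\<^bsub>poly_ring n\<^esub> q = p - q"
    by (simp add: a_minus_def)
  moreover have "p - q \<in> carrier (poly_ring n)"
    using poly_ring_closed(1)[OF assms(1) poly_ring_closed(3)[OF assms(2,1)]] by simp
  ultimately show ?thesis
    using R.quotient_eq_iff_same_a_r_cos[OF ideal_VG_ideal assms]
    by (simp add: VG_ideal_eq VG_cong_def)
qed

text \<open>Symmetrizing an invariant multiplies it by \<open>fact n\<close>, which is invertible
  over the rationals, and the symmetrization is a polynomial in the star sum. Conversely,
  permutations fixing \<open>n+1\<close> only permute the summands of the star sum.\<close>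

lemma carrier_VG_invariants:
  "carrier (VG_invariants n) =
    (\<lambda>q. VG_ideal n +>\<^bsub>poly_ring n\<^esub> eval_at (star_sum n (n+1)) q) ` UNIV"
  (is "_ = ?h ` UNIV")
proof (intro equalityI subsetI)
  let ?z = "star_sum n (n+1)"
  have carrier: "carrier (VG n) = (\<lambda>p. VG_ideal n +>\<^bsub>poly_ring n\<^esub> p) ` carrier (poly_ring n)"
    by (auto simp: VG_def FactRing_def A_RCOSETS_def')
  {
    fix C assume C: "C \<in> carrier (VG_invariants n)"
    then obtain p where p: "p \<in> carrier (poly_ring n)" "C = VG_ideal n +>\<^bsub>poly_ring n\<^esub> p"
      by (auto simp: VG_invariants_def carrier)
    have "VG_cong n (perm_poly \<sigma> p) p" if "\<sigma> permutes {1..n}" for \<sigma>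
    proof -
      have \<sigma>: "\<sigma> permutes {1..n+1}" "\<sigma> (n+1) = n+1"
        using permutes_Suc[OF that] permutes_not_in[OF that] by auto
      then have "perm_VG \<sigma> C = C"
        using C unfolding VG_invariants_def by simp
      then show ?thesis
        using VG_coset_eq_iff perm_poly_closed \<sigma>(1) p by (simp add: perm_VG_coset)
    qed
    then have "VG_cong n (symmetrize n p) (\<Sum>\<sigma> | \<sigma> permutes {1..n}. p)"
      unfolding symmetrize_def by (intro VG_cong_sum) auto
    also have "(\<Sum>\<sigma> | \<sigma> permutes {1..n}. p) = mconst (of_nat (fact n)) * p"
      using of_nat_eq_mconst[of "fact n"] by (simp add: card_permutations[of _ n])
    finally have sym: "VG_cong n (mconst (of_nat (fact n)) * p) (symmetrize n p)"
      by (rule VG_cong_sym)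
    obtain q where "VG_cong n (symmetrize n p) (eval_at ?z q)"
      using star_poly_symmetrize[OF p(1)] unfolding star_poly_def by blast
    from VG_cong_mult_left[OF VG_cong_trans[OF sym this], of "mconst (1 / of_nat (fact n))"]
    have "VG_cong n p (eval_at ?z (smult (1 / of_nat (fact n)) q))"
      by (simp add: eval_at_smult mult.assoc[symmetric] mconst_simps(4)[symmetric] mconst_simps(2))
    then have "C = ?h (smult (1 / of_nat (fact n)) q)"
      using VG_coset_eq_iff p eval_at_closed star_sum_top_closed by blast
    then show "C \<in> ?h ` UNIV" by blast
  next
    fix C assume "C \<in> ?h ` UNIV"
    then obtain q where C: "C = ?h q" by blast
    have "perm_VG \<sigma> C = C" if "\<sigma> permutes {1..n+1}" "\<sigma> (n+1) = n+1" for \<sigma>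
    proof -
      have "\<sigma> permutes {1..n}"
        using that(1) by (rule permutes_superset) (use that(2) in \<open>auto simp: le_Suc_eq\<close>)
      then show ?thesis
        unfolding C perm_VG_coset[OF that(1)] perm_poly_eval_at
        by (simp only: perm_poly_star_sum_top)
    qed
    moreover have "C \<in> carrier (VG n)"
      unfolding carrier C by (intro imageI eval_at_closed star_sum_top_closed)
    ultimately show "C \<in> carrier (VG_invariants n)"
      unfolding VG_invariants_def by simp
  }
qed

lemma rat_poly_ring_simps [simp]:
  "carrier rat_poly_ring = UNIV"
  "p \<otimes>\<^bsub>rat_poly_ring\<^esub> q = p * q" "p \<oplus>\<^bsub>rat_poly_ring\<^esub> q = p + q"
  "\<one>\<^bsub>rat_poly_ring\<^esub> = 1" "\<zero>\<^bsub>rat_poly_ring\<^esub> = 0"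
  by (simp_all add: rat_poly_ring_def ring_of_type_algebra_def)

text \<open>First isomorphism theorem for evaluation at the class of the star sum.\<close>

theorem theorem1p1:
  fixes n :: nat
  assumes "n \<ge> 2"
  shows "VG_invariants n \<simeq> rat_poly_ring Quot (Idl\<^bsub>rat_poly_ring\<^esub> {[:0, 1:] ^ (n + 1)})"
proof -
  let ?X = "[:0, 1:] ^ (n + 1) :: rat poly"
  let ?z = "star_sum n (n+1)"
  define h where "h = (\<lambda>q. VG_ideal n +>\<^bsub>poly_ring n\<^esub> eval_at ?z q)"
  interpret P: cring rat_poly_ring
    unfolding rat_poly_ring_def by (rule cring_from_type_algebra)
  interpret V: cring "VG n" by (rule cring_VG)
  interpret I: ideal "VG_ideal n" "poly_ring n" by (rule ideal_VG_ideal)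
  have "eval_at ?z \<in> ring_hom rat_poly_ring (poly_ring n)"
    by (rule ring_hom_memI)
      (auto simp: eval_at_closed[OF star_sum_top_closed, simplified] eval_at_mult eval_at_add)
  from ring_hom_trans[OF this I.rcos_ring_hom]
  have hom: "h \<in> ring_hom rat_poly_ring (VG n)"
    by (simp add: VG_def h_def comp_def)
  interpret h: ring_hom_ring rat_poly_ring "VG n" h
    by (intro ring_hom_ringI2 P.ring_axioms V.ring_axioms hom)
  have h_zero: "h q = \<zero>\<^bsub>VG n\<^esub> \<longleftrightarrow> ?X dvd q" for q
  proof -
    have "\<zero>\<^bsub>VG n\<^esub> = h 0" using h.hom_zero by simp
    then show ?thesis
      using VG_coset_eq_iff[OF eval_at_closed[OF star_sum_top_closed] poly_ring_0_1(1)]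
      by (simp only: h_def eval_at_0 VG_cong_eval_at_star_sum_iff)
  qed
  have Idl: "Idl\<^bsub>rat_poly_ring\<^esub> {?X} = {q. ?X dvd q}"
    by (auto simp: P.cgenideal_eq_genideal[symmetric] cgenideal_def dvd_def mult.commute)
  have ker: "a_kernel rat_poly_ring (VG n) h = Idl\<^bsub>rat_poly_ring\<^esub> {?X}"
    by (simp only: a_kernel_def' rat_poly_ring_simps UNIV_I simp_thms h_zero Idl)
  \<comment> \<open>The image ring delivered by the isomorphism theorem is \<open>VG n\<close> with
    its carrier restricted, so agreement of carriers gives equality of records.\<close>
  have img: "VG_invariants n = VG n \<lparr>carrier := h ` carrier rat_poly_ring\<rparr>"
  proof -
    have "h ` carrier rat_poly_ring = carrier (VG_invariants n)"
      by (simp only: carrier_VG_invariants h_def rat_poly_ring_simps)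
    then show ?thesis by (simp add: VG_invariants_def)
  qed
  have "rat_poly_ring Quot (Idl\<^bsub>rat_poly_ring\<^esub> {?X}) \<simeq> VG_invariants n"
    using h.FactRing_iso_set_aux unfolding ker img is_ring_iso_def by blast
  moreover have "ring (rat_poly_ring Quot (Idl\<^bsub>rat_poly_ring\<^esub> {?X}))"
    using ideal.quotient_is_ring[OF h.kernel_is_ideal] unfolding ker .
  ultimately show ?thesis
    by (rule ring_iso_sym[rotated])
qed

end
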